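(* Let $\xi$ be a non-null countable ordinal. Then: (a) there is a language $A \subseteq 2^{<\omega}$ such that the $\omega$-power $A^\omega$ is a ${\bf\Sigma}^0_\xi$-complete subset of $2^\omega$; (b) there is a language $A \subseteq 2^{<\omega}$ such that the $\omega$-power $A^\omega$ is a ${\bf\Pi}^0_\xi$-complete subset of $2^\omega$.
   Context: $2=\{0,1\}$; $2^{<\omega}$ is the set of finite words over $\{0,1\}$ and $2^\omega$ the set of infinite ($\omega$-)words over $\{0,1\}$, equipped with the Cantor topology (product of the discrete topology on $\{0,1\}$; basic open sets are $N_s=\{\alpha\in 2^\omega : s \text{ is a prefix of } \alpha\}$ for $s\in 2^{<\omega}$). For $V\subseteq 2^{<\omega}$, the $\omega$-power of $V$ is $V^\omega=\{u_1u_2\cdots u_n\cdots \in 2^\omega : u_i\in V \text{ for all } i\ge 1\}$. Borel hierarchy: ${\bf\Sigma}^0_1$ = open sets, ${\bf\Pi}^0_1$ = closed sets; for a countable ordinal $\xi\ge 2$, ${\bf\Sigma}^0_\xi$ is the class of countable unions of sets in $\bigcup_{\gamma<\xi}{\bf\Pi}^0_\gamma$ and ${\bf\Pi}^0_\xi$ the class of countable intersections of sets in $\bigcup_{\gamma<\xi}{\bf\Sigma}^0_\gamma$. A set $F\subseteq 2^\omega$ is ${\bf\Sigma}^0_\xi$-complete (resp. ${\bf\Pi}^0_\xi$-complete) iff for every finite alphabet $Y$ and every $E\subseteq Y^\omega$: $E\in{\bf\Sigma}^0_\xi$ (resp. ${\bf\Pi}^0_\xi$) iff $E=g^{-1}(F)$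 for some continuous $g:Y^\omega\to 2^\omega$; equivalently, $F$ is in ${\bf\Sigma}^0_\xi$ but not in ${\bf\Pi}^0_\xi$ (resp. in ${\bf\Pi}^0_\xi$ but not in ${\bf\Sigma}^0_\xi$). *)

theory Defs
  imports "HOL-Analysis.Analysis"
begin

text \<open>
  The space of infinite words over the alphabet \<open>Y\<close>. Its underlying set consists of all sequences
  with values in \<open>Y\<close>; the space \<open>2\<^sup>\<omega>\<close> is \<open>omega_words (UNIV :: bool set)\<close>.
\<close>

definition omega_words :: "'a set \<Rightarrow> (nat \<Rightarrow> 'a) topology" where
  "omega_words Y = product_topology (\<lambda>_. discrete_topology Y) UNIV"

text \<open>
  An infinite word \<open>\<alpha>\<close> is the concatenation of \<open>u 0, u 1, \<dots>\<close> if all finite partial concatenations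
  are prefixes of \<open>\<alpha>\<close> and their lengths are unbounded. The latter clause matters when the language
  contains the empty word: sequences whose concatenation is a finite word contribute nothing.
\<close>

definition omega_power :: "'a list set \<Rightarrow> (nat \<Rightarrow> 'a) set" where
  "omega_power V = {\<alpha>. \<exists>u :: nat \<Rightarrow> 'a list.
     (\<forall>i. u i \<in> V) \<and>
     (\<forall>n. let w = concat (map u [0..<n]) in \<forall>k < length w. w ! k = \<alpha> k) \<and>
     (\<forall>m. \<exists>n. m \<le> length (concat (map u [0..<n])))}"

text \<open>
  A countable ordinal is represented by a well-order \<open>\<xi>\<close> on a set \<open>Field \<xi>\<close> of natural numbers; every
  countable ordinal is the order type of such a relation. The ordinal 0 is represented by the empty
  relation, 1 by the relations whose field is a singleton, and \<open>(\<gamma>, \<xi>) \<in> ordLess\<close> says that \<open>\<gamma>\<close> and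
  \<open>\<xi>\<close> are well-orders and that the order type of \<open>\<gamma>\<close> is less than that of \<open>\<xi>\<close>.

  No rule produces a set at level 0, so the levels \<open>\<gamma> n\<close> below are non-null, and the last two rules
  apply to \<open>\<xi>\<close> of order type at least 2 only.
\<close>

inductive Sigma0 :: "'a topology \<Rightarrow> nat rel \<Rightarrow> 'a set \<Rightarrow> bool"
  and Pi0 :: "'a topology \<Rightarrow> nat rel \<Rightarrow> 'a set \<Rightarrow> bool"
  for X :: "'a topology" where
  Sigma0_open: "\<lbrakk>Well_order \<xi>; card (Field \<xi>) = 1; openin X S\<rbrakk> \<Longrightarrow> Sigma0 X \<xi> S"
| Pi0_closed: "\<lbrakk>Well_order \<xi>; card (Field \<xi>) = 1; closedin X S\<rbrakk> \<Longrightarrow> Pi0 X \<xi> S"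
| Sigma0_Union: "\<lbrakk>\<And>n::nat. (\<gamma> n, \<xi>) \<in> ordLess; \<And>n. Pi0 X (\<gamma> n) (S n)\<rbrakk>
    \<Longrightarrow> Sigma0 X \<xi> (\<Union>n. S n)"
| Pi0_Inter: "\<lbrakk>\<And>n::nat. (\<gamma> n, \<xi>) \<in> ordLess; \<And>n. Sigma0 X (\<gamma> n) (S n)\<rbrakk>
    \<Longrightarrow> Pi0 X \<xi> (\<Inter>n. S n)"

text \<open>
  Completeness of a subset of \<open>2\<^sup>\<omega>\<close> quantifies over all finite alphabets; these are taken, up to
  renaming of letters, to be the finite non-empty sets of natural numbers.
\<close>

definition Sigma0_complete :: "nat rel \<Rightarrow> (nat \<Rightarrow> bool) set \<Rightarrow> bool" where
  "Sigma0_complete \<xi> F \<longleftrightarrow>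
     (\<forall>Y :: nat set. finite Y \<and> Y \<noteq> {} \<longrightarrow>
       (\<forall>E \<subseteq> topspace (omega_words Y).
          Sigma0 (omega_words Y) \<xi> E \<longleftrightarrow>
          (\<exists>g. continuous_map (omega_words Y) (omega_words (UNIV :: bool set)) g \<and>
               E = {\<alpha> \<in> topspace (omega_words Y). g \<alpha> \<in> F})))"

definition Pi0_complete :: "nat rel \<Rightarrow> (nat \<Rightarrow> bool) set \<Rightarrow> bool" where
  "Pi0_complete \<xi> F \<longleftrightarrow>
     (\<forall>Y :: nat set. finite Y \<and> Y \<noteq> {} \<longrightarrow>
       (\<forall>E \<subseteq> topspace (omega_words Y).
          Pi0 (omega_words Y) \<xi> E \<longleftrightarrow>
          (\<exists>g. continuous_map (omega_words Y) (omega_words (UNIV :: bool set)) g \<and>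
               E = {\<alpha> \<in> topspace (omega_words Y). g \<alpha> \<in> F})))"

end

theory Submission
  imports Defs "HOL-Library.Omega_Words_Fun"
begin

text \<open>
  Every set \<open>B\<close> in one of the classes is accepted by a countable transition system with open labels
  for which the sets accepted from the other states lie in the same class as well; this follows by
  induction along the hierarchy. The infinite words \<open>\<beta>\<close> are coded by words that offer, for every
  state, cut positions at which the remaining word determines that position. The language \<open>A\<close> consists
  of the segments between two cut positions that correspond to legal transitions, so that the code
  of \<open>\<beta>\<close> is in \<open>A\<^sup>\<omega>\<close> iff \<open>\<beta>\<close> is accepted, and of all words that are not prefixes of codes. Because of
  the latter, and since every word that starts with \<open>0\<close> or \<open>11\<close> is among them, an infinite word that
  leaves the codes at a finite stage is in \<open>A\<^sup>\<omega>\<close>. So up to a single word, \<open>A\<^sup>\<omega>\<close> is the union of an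
  open set and the codes of the accepted words, and its complement the codes of the rejected words.
  This gives the upper bounds from level 2 on, level 1 being easy, and the coding of \<open>\<beta>\<close> reduces \<open>B\<close>,
  which is taken complete, to \<open>A\<^sup>\<omega>\<close>.
\<close>

unbundle cardinal_syntax

section \<open>The Borel hierarchy\<close>

lemma ordLess_Well_order: "(r, s) \<in> ordLess \<Longrightarrow> Well_order r \<and> Well_order s"
  by (simp add: ordLess_def)

text \<open>The union and intersection rules call for levels strictly below \<xi>, so \<xi> cannot
  be null.\<close>

lemma Sigma0_level:
  "Sigma0 X \<xi> S \<Longrightarrow> Well_order \<xi> \<and> Field \<xi> \<noteq> {}"
  "Pi0 X \<xi> S \<Longrightarrow> Well_order \<xi> \<and> Field \<xi> \<noteq> {}"
proof (induction rule: Sigma0_Pi0.inducts)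
  case (Sigma0_Union \<gamma> \<xi> S)
  have "\<gamma> 0 <o \<xi>" by (rule Sigma0_Union)
  then show ?case
    by (metis (no_types, lifting) ordLess_iff_ordIso_Restr ordLess_Well_order empty_iff)
next
  case (Pi0_Inter \<gamma> \<xi> S)
  have "\<gamma> 0 <o \<xi>" by (rule Pi0_Inter)
  then show ?case
    by (metis (no_types, lifting) ordLess_iff_ordIso_Restr ordLess_Well_order empty_iff)
qed auto

lemma Sigma0_subset_topspace:
  "Sigma0 X \<xi> S \<Longrightarrow> S \<subseteq> topspace X"
  "Pi0 X \<xi> S \<Longrightarrow> S \<subseteq> topspace X"
  by (induction rule: Sigma0_Pi0.inducts) (blast dest: openin_subset closedin_subset)+

lemma Sigma0_compl:
  "Sigma0 X \<xi> S \<Longrightarrow> Pi0 X \<xi> (topspace X - S)"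
  "Pi0 X \<xi> S \<Longrightarrow> Sigma0 X \<xi> (topspace X - S)"
proof (induction rule: Sigma0_Pi0.inducts)
  case (Sigma0_Union \<gamma> \<xi> S)
  have "Pi0 X \<xi> (\<Inter>n. topspace X - S n)"
    using Sigma0_Union by (intro Pi0_Inter[of \<gamma>]) auto
  then show ?case by (rule back_subst[of "Pi0 X \<xi>"]) auto
next
  case (Pi0_Inter \<gamma> \<xi> S)
  have "Sigma0 X \<xi> (\<Union>n. topspace X - S n)"
    using Pi0_Inter by (intro Sigma0_Union[of \<gamma>]) auto
  then show ?case by (rule back_subst[of "Sigma0 X \<xi>"]) auto
qed (blast intro: Sigma0_open Pi0_closed closedin_diff openin_diff closedin_topspace openin_topspace)+

lemma Sigma0_compl_iff:
  assumes "S \<subseteq> topspace X"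
  shows "Sigma0 X \<xi> (topspace X - S) \<longleftrightarrow> Pi0 X \<xi> S"
  using Sigma0_compl[of X \<xi> S] Sigma0_compl(1)[of X \<xi> "topspace X - S"] assms
  by (auto simp: double_diff)

lemma Sigma0_preimage:
  assumes g: "continuous_map Y X g"
  shows "Sigma0 X \<xi> S \<Longrightarrow> Sigma0 Y \<xi> {x \<in> topspace Y. g x \<in> S}"
    and "Pi0 X \<xi> S \<Longrightarrow> Pi0 Y \<xi> {x \<in> topspace Y. g x \<in> S}"
proof (induction rule: Sigma0_Pi0.inducts)
  case (Sigma0_open \<xi> S)
  then show ?case using g by (auto intro!: Sigma0_Pi0.Sigma0_open openin_continuous_map_preimage)
next
  case (Pi0_closed \<xi> S)
  then show ?case using g by (auto intro!: Sigma0_Pi0.Pi0_closed closedin_continuous_map_preimage)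
next
  case (Sigma0_Union \<gamma> \<xi> S)
  have "Sigma0 Y \<xi> (\<Union>n. {x \<in> topspace Y. g x \<in> S n})"
    using Sigma0_Union by (intro Sigma0_Pi0.Sigma0_Union[of \<gamma>]) auto
  then show ?case by (rule back_subst[of "Sigma0 Y \<xi>"]) auto
next
  case (Pi0_Inter \<gamma> \<xi> S)
  have "Pi0 Y \<xi> (\<Inter>n. {x \<in> topspace Y. g x \<in> S n})"
    using Pi0_Inter by (intro Sigma0_Pi0.Pi0_Inter[of \<gamma>]) auto
  then show ?case by (rule back_subst[of "Pi0 Y \<xi>"]) auto
qed

section \<open>Level 1 and comparison of levels\<close>

definition ord_one :: "nat rel" where
  "ord_one = {(0, 0)}"

lemma Field_ord_one [simp]: "Field ord_one = {0}"
  by (simp add: ord_one_def)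

lemma Well_order_ord_one: "Well_order ord_one"
  unfolding well_order_on_def linear_order_on_def partial_order_on_def
    preorder_on_def ord_one_def
  by (auto simp: refl_on_def trans_def antisym_def total_on_def Field_def)

text \<open>Otherwise \<xi> embeds into a one-element order, which leaves just one element for its
  non-empty field.\<close>

lemma ord_one_ordLess:
  fixes \<xi> :: "nat rel"
  assumes "Well_order \<xi>" "Field \<xi> \<noteq> {}" "card (Field \<xi>) \<noteq> 1"
  shows "ord_one <o \<xi>"
proof (rule ccontr)
  assume "\<not> ord_one <o \<xi>"
  then have "\<xi> \<le>o ord_one"
    using assms(1) Well_order_ord_one ordLess_or_ordLeq by blast
  then obtain f where "embed \<xi> ord_one f"
    by (auto simp: ordLeq_def)
  with assms(1) have "inj_on f (Field \<xi>)" "f ` Field \<xi> \<subseteq> {0}"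
    using embed_inj_on embed_Field by force+
  then have "card (Field \<xi>) \<le> card {0::nat}" "finite (Field \<xi>)"
    by (blast intro: card_inj_on_le finite_imageD[OF finite_subset])+
  with assms show False
    by (auto simp: le_Suc_eq)
qed

text \<open>A smaller order is isomorphic to the initial segment below some element, and in a
  one-element order this segment is empty.\<close>

lemma not_ordLess_one:
  fixes \<gamma> \<xi> :: "nat rel"
  assumes "\<gamma> <o \<xi>" "Field \<gamma> \<noteq> {}"
  shows "card (Field \<xi>) \<noteq> 1"
proof
  assume "card (Field \<xi>) = 1"
  then obtain a where a: "Field \<xi> = {a}"
    by (auto simp: card_1_singleton_iff)
  from assms obtain b where b: "b \<in> Field \<xi>" "(\<gamma>, Restr \<xi> (underS \<xi> b)) \<in> ordIso"
    using ordLess_iff_ordIso_Restr ordLess_Well_order by blast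
  have "underS \<xi> b = {}"
    using a b(1) by (auto simp: underS_def Field_def)
  then have "Restr \<xi> (underS \<xi> b) = {}"
    by simp
  with b(2) obtain f where "bij_betw f (Field \<gamma>) (Field ({} :: nat rel))"
    by (auto simp: ordIso_def iso_def)
  with assms(2) show False
    by (auto simp: bij_betw_def)
qed

text \<open>At order type 1 the union and intersection rules cannot have been applied, as they call
  for a non-null level below.\<close>

lemma Sigma0_one_iff:
  assumes "Well_order \<xi>" "card (Field \<xi>) = 1"
  shows "Sigma0 X \<xi> S \<longleftrightarrow> openin X S" "Pi0 X \<xi> S \<longleftrightarrow> closedin X S"
proof -
  have "openin X S" if "Sigma0 X \<xi> S"
    using that
  proof cases
    case (Sigma0_Union \<gamma> T)
    then show ?thesis
      using Sigma0_level(2)[of X "\<gamma> 0" "T 0"] not_ordLess_one assms by blast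
  qed
  moreover have "closedin X S" if "Pi0 X \<xi> S"
    using that
  proof cases
    case (Pi0_Inter \<gamma> T)
    then show ?thesis
      using Sigma0_level(1)[of X "\<gamma> 0" "T 0"] not_ordLess_one assms by blast
  qed
  ultimately show "Sigma0 X \<xi> S \<longleftrightarrow> openin X S" "Pi0 X \<xi> S \<longleftrightarrow> closedin X S"
    using assms by (auto intro: Sigma0_open Pi0_closed)
qed

lemma Sigma0_Union_cases:
  assumes "Sigma0 X \<xi> S" "card (Field \<xi>) \<noteq> 1"
  obtains \<gamma> T where "\<And>n::nat. \<gamma> n <o \<xi>" "\<And>n. Pi0 X (\<gamma> n) (T n)" "S = (\<Union>n. T n)"
  using assms(1)
proof cases
  case Sigma0_open
  then show ?thesis using assms(2) by simp
next
  case Sigma0_Union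
  then show ?thesis using that by blast
qed

text \<open>Serves to replace a level below \<xi> by an initial segment of \<xi> of the same order
  type.\<close>

lemma Pi0_ordIso:
  assumes "Pi0 X \<gamma> S" "(\<gamma>, \<delta>) \<in> ordIso"
  shows "Pi0 X \<delta> S"
  using assms(1)
proof cases
  case Pi0_closed
  from assms(2) obtain f where "Well_order \<delta>" "bij_betw f (Field \<gamma>) (Field \<delta>)"
    by (auto simp: ordIso_def iso_def)
  then show ?thesis
    using Pi0_closed bij_betw_same_card by (metis Sigma0_Pi0.Pi0_closed)
next
  case (Pi0_Inter \<alpha> T)
  then show ?thesis
    using assms(2) ordLess_ordIso_trans by (blast intro: Sigma0_Pi0.Pi0_Inter)
qed

lemma Pi0_imp_Sigma0:
  assumes "Pi0 X \<gamma> S" "\<gamma> <o \<xi>"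
  shows "Sigma0 X \<xi> S"
  using Sigma0_Union[of "\<lambda>_. \<gamma>" \<xi> X "\<lambda>_. S"] assms by simp

lemma closedin_imp_Sigma0:
  assumes "Well_order \<xi>" "Field \<xi> \<noteq> {}" "card (Field \<xi>) \<noteq> 1" "closedin X S"
  shows "Sigma0 X \<xi> S"
  by (rule Pi0_imp_Sigma0[OF Pi0_closed[of ord_one] ord_one_ordLess])
    (use assms Well_order_ord_one in auto)

text \<open>The countable unions behind the sets \<open>S n\<close> are merged into a single one by
  the pairing function.\<close>

lemma Sigma0_UN:
  assumes "card (Field \<xi>) \<noteq> 1" "\<And>n::nat. Sigma0 X \<xi> (S n)"
  shows "Sigma0 X \<xi> (\<Union>n. S n)"
proof -
  have "\<exists>\<gamma> T. (\<forall>k::nat. \<gamma> k <o \<xi>) \<and> (\<forall>k. Pi0 X (\<gamma> k) (T k)) \<and> S n = (\<Union>k. T k)" for n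
    using Sigma0_Union_cases[OF assms(2)[of n] assms(1)] by metis
  then obtain \<gamma> T where T: "\<And>n k::nat. \<gamma> n k <o \<xi>" "\<And>n k. Pi0 X (\<gamma> n k) (T n k)"
      "\<And>n. S n = (\<Union>k. T n k)"
    by metis
  have "Sigma0 X \<xi> (\<Union>i. T (fst (prod_decode i)) (snd (prod_decode i)))"
    by (rule Sigma0_Union[of "\<lambda>i. \<gamma> (fst (prod_decode i)) (snd (prod_decode i))"]) (simp_all add: T)
  also have "(\<Union>i. T (fst (prod_decode i)) (snd (prod_decode i))) = (\<Union>n. S n)"
    unfolding T(3) by (auto, metis fst_conv snd_conv prod_encode_inverse)
  finally show ?thesis .
qed

section \<open>Topology of infinite words\<close>

lemma topspace_omega_words [simp]: "topspace (omega_words Y) = {\<alpha>. \<forall>i. \<alpha> i \<in> Y}"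
  by (auto simp: omega_words_def PiE_iff)

lemma continuous_map_omega_words_iff:
  "continuous_map X (omega_words UNIV) g \<longleftrightarrow> (\<forall>i. continuous_map X (discrete_topology UNIV) (\<lambda>x. g x i))"
  unfolding omega_words_def by (rule continuous_map_componentwise_UNIV)

lemma openin_omega_words_cylinder:
  "openin (omega_words Y) {\<alpha>. (\<forall>i. \<alpha> i \<in> Y) \<and> (\<forall>i<n. \<alpha> i = \<beta> i)}"
proof (cases "\<forall>i<n. \<beta> i \<in> Y")
  case True
  define U where "U = (\<lambda>i. if i < n then {\<beta> i} else Y)"
  have "openin (omega_words Y) (Pi\<^sub>E UNIV U)"
    unfolding omega_words_def
  proof (rule product_topology_basis)
    show "finite {i. U i \<noteq> topspace (discrete_topology Y)}"
      by (rule finite_subset[of _ "{..<n}"]) (auto simp: U_def)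
  qed (use True in \<open>auto simp: U_def\<close>)
  also have "Pi\<^sub>E UNIV U = {\<alpha>. (\<forall>i. \<alpha> i \<in> Y) \<and> (\<forall>i<n. \<alpha> i = \<beta> i)}"
  proof (intro equalityI subsetI)
    fix \<alpha> assume "\<alpha> \<in> Pi\<^sub>E UNIV U"
    then have "\<alpha> i \<in> (if i < n then {\<beta> i} else Y)" for i
      by (simp add: PiE_iff U_def)
    then have "\<alpha> i \<in> Y \<and> (i < n \<longrightarrow> \<alpha> i = \<beta> i)" for i
      using True by (cases "i < n") (metis singletonD, metis)
    then show "\<alpha> \<in> {\<alpha>. (\<forall>i. \<alpha> i \<in> Y) \<and> (\<forall>i<n. \<alpha> i = \<beta> i)}"
      by blast
  qed (simp add: PiE_iff U_def)
  finally show ?thesis .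
next
  case False
  then have "\<not> ((\<forall>i. \<alpha> i \<in> Y) \<and> (\<forall>i<n. \<alpha> i = \<beta> i))" for \<alpha>
    by metis
  then have "{\<alpha>. (\<forall>i. \<alpha> i \<in> Y) \<and> (\<forall>i<n. \<alpha> i = \<beta> i)} = {}"
    by blast
  then show ?thesis by (simp only: openin_empty)
qed

text \<open>A basic open set restricts finitely many coordinates, so around each of its points it
  contains a cylinder given by a prefix.\<close>

lemma openin_omega_words_iff:
  "openin (omega_words Y) S \<longleftrightarrow>
    (\<forall>\<alpha>\<in>S. (\<forall>i. \<alpha> i \<in> Y) \<and> (\<exists>n. \<forall>\<beta>. (\<forall>i. \<beta> i \<in> Y) \<and> (\<forall>i<n. \<beta> i = \<alpha> i) \<longrightarrow> \<beta> \<in> S))"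
  (is "?L \<longleftrightarrow> ?R")
proof
  assume L: ?L
  show ?R
  proof
    fix \<alpha> assume "\<alpha> \<in> S"
    with L obtain U where "finite {i \<in> UNIV. U i \<noteq> Y} \<and> (\<forall>i\<in>UNIV. U i \<subseteq> Y) \<and>
        \<alpha> \<in> Pi\<^sub>E UNIV U \<and> Pi\<^sub>E UNIV U \<subseteq> S"
      unfolding omega_words_def openin_product_topology_alt
        topspace_discrete_topology openin_discrete_topology by (meson \<open>\<alpha> \<in> S\<close>)
    then have U: "finite {i. U i \<noteq> Y}" "\<alpha> \<in> Pi\<^sub>E UNIV U" "Pi\<^sub>E UNIV U \<subseteq> S" "\<And>i. U i \<subseteq> Y"
      by simp_all
    from U(1) obtain n where "\<forall>i\<in>{i. U i \<noteq> Y}. i < n"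
      using finite_nat_set_iff_bounded by metis
    then have n: "U i = Y" if "\<not> i < n" for i
      using that by blast
    have "\<beta> \<in> S" if "\<forall>i. \<beta> i \<in> Y" "\<forall>i<n. \<beta> i = \<alpha> i" for \<beta>
    proof -
      have "\<beta> i \<in> U i" for i
        using that n[of i] U(2) by (cases "i < n") (auto simp: PiE_iff)
      then have "\<beta> \<in> Pi\<^sub>E UNIV U" by (simp add: PiE_iff)
      with U(3) show ?thesis by (rule subsetD)
    qed
    moreover have "\<forall>i. \<alpha> i \<in> Y"
      using U(2,4) by (auto simp: PiE_iff)
    ultimately show "(\<forall>i. \<alpha> i \<in> Y) \<and> (\<exists>n. \<forall>\<beta>. (\<forall>i. \<beta> i \<in> Y) \<and> (\<forall>i<n. \<beta> i = \<alpha> i) \<longrightarrow> \<beta> \<in> S)"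
      by blast
  qed
next
  assume R: ?R
  show ?L
  proof (rule openin_subopen[THEN iffD2], rule ballI)
    fix \<alpha> assume "\<alpha> \<in> S"
    from bspec[OF R this] obtain n
      where "\<forall>i. \<alpha> i \<in> Y" "\<forall>\<beta>. (\<forall>i. \<beta> i \<in> Y) \<and> (\<forall>i<n. \<beta> i = \<alpha> i) \<longrightarrow> \<beta> \<in> S"
      by auto
    then show "\<exists>T. openin (omega_words Y) T \<and> \<alpha> \<in> T \<and> T \<subseteq> S"
      using \<open>\<alpha> \<in> S\<close> openin_omega_words_cylinder[of Y n \<alpha>]
      by (intro exI[of _ "{\<beta>. (\<forall>i. \<beta> i \<in> Y) \<and> (\<forall>i<n. \<beta> i = \<alpha> i)}"]) (simp add: subset_iff)
  qed
qed

lemma openin_omega_words_finite_dep: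
  assumes "S \<subseteq> topspace (omega_words Y)"
    and "\<And>\<alpha> \<beta>. \<alpha> \<in> S \<Longrightarrow> \<forall>i. \<beta> i \<in> Y \<Longrightarrow> (\<And>i. i < n \<Longrightarrow> \<beta> i = \<alpha> i) \<Longrightarrow> \<beta> \<in> S"
  shows "openin (omega_words Y) S"
  unfolding openin_omega_words_iff
proof
  fix \<alpha> assume "\<alpha> \<in> S"
  with assms(1) have "\<forall>i. \<alpha> i \<in> Y" by auto
  moreover have "\<forall>\<beta>. (\<forall>i. \<beta> i \<in> Y) \<and> (\<forall>i<n. \<beta> i = \<alpha> i) \<longrightarrow> \<beta> \<in> S"
    using assms(2)[OF \<open>\<alpha> \<in> S\<close>] by simp
  ultimately show "(\<forall>i. \<alpha> i \<in> Y) \<and> (\<exists>n. \<forall>\<beta>. (\<forall>i. \<beta> i \<in> Y) \<and> (\<forall>i<n. \<beta> i = \<alpha> i) \<longrightarrow> \<beta> \<in> S)"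
    by blast
qed

lemma continuous_map_omega_words_finite_dep:
  assumes "\<And>i. \<exists>n. \<forall>\<alpha> \<beta>. (\<forall>j. \<alpha> j \<in> Y) \<longrightarrow> (\<forall>j. \<beta> j \<in> Y) \<longrightarrow> (\<forall>j<n. \<beta> j = \<alpha> j) \<longrightarrow> g \<beta> i = g \<alpha> i"
  shows "continuous_map (omega_words Y) (omega_words UNIV) g"
  unfolding continuous_map_omega_words_iff
proof
  fix i
  obtain n where n: "\<And>\<alpha> \<beta>. \<forall>j. \<alpha> j \<in> Y \<Longrightarrow> \<forall>j. \<beta> j \<in> Y \<Longrightarrow> \<forall>j<n. \<beta> j = \<alpha> j \<Longrightarrow> g \<beta> i = g \<alpha> i"
    using assms[of i] by blast
  have "openin (omega_words Y) {\<alpha> \<in> topspace (omega_words Y). g \<alpha> i \<in> U}" for U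
  proof (rule openin_omega_words_finite_dep[of _ _ n])
    fix \<alpha> \<beta> assume "\<alpha> \<in> {\<alpha> \<in> topspace (omega_words Y). g \<alpha> i \<in> U}"
      and \<beta>: "\<forall>i. \<beta> i \<in> Y" "\<And>i. i < n \<Longrightarrow> \<beta> i = \<alpha> i"
    moreover from this have "g \<beta> i = g \<alpha> i"
      by (intro n) auto
    ultimately show "\<beta> \<in> {\<alpha> \<in> topspace (omega_words Y). g \<alpha> i \<in> U}"
      by simp
  qed auto
  then show "continuous_map (omega_words Y) (discrete_topology UNIV) (\<lambda>\<alpha>. g \<alpha> i)"
    by (auto simp: continuous_map_def)
qed

lemma continuous_map_omega_words_reindex:
  "continuous_map (omega_words UNIV) (omega_words UNIV) (\<lambda>\<beta> i. \<beta> (f i))"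
  by (rule continuous_map_omega_words_finite_dep, rule_tac x = "Suc (f i)" in exI) simp

text \<open>\<open>G n\<close> consists of the words that agree with an element of \<open>K\<close>
  on \<open>n\<close> letters; a word in all of them is a limit of elements of \<open>K\<close>.
  Monotonicity serves the transition system for closed sets.\<close>

lemma closedin_omega_words_decomp:
  assumes "closedin (omega_words Y) K"
  obtains G where "\<And>n. openin (omega_words Y) (G n)" "decseq G" "K = (\<Inter>n::nat. G n)"
proof
  define G where "G n = {\<alpha>. (\<forall>i. \<alpha> i \<in> Y) \<and> (\<exists>\<beta>\<in>K. \<forall>i<n. \<beta> i = \<alpha> i)}" for n
  show "openin (omega_words Y) (G n)" for n
    by (rule openin_omega_words_finite_dep[of _ _ n]) (auto simp: G_def)
  show "decseq G"
    unfolding decseq_def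
  proof (intro allI impI subsetI)
    fix m n \<alpha> assume "m \<le> n" and "\<alpha> \<in> G n"
    then obtain \<beta> where "\<beta> \<in> K" "\<forall>i<n. \<beta> i = \<alpha> i" "\<forall>i. \<alpha> i \<in> Y"
      unfolding G_def by blast
    with \<open>m \<le> n\<close> show "\<alpha> \<in> G m"
      unfolding G_def by (intro CollectI conjI bexI[of _ \<beta>]) simp_all
  qed
  have K: "K \<subseteq> topspace (omega_words Y)" and "openin (omega_words Y) (topspace (omega_words Y) - K)"
    using assms by (auto simp: closedin_def)
  note compl = this(2)[unfolded openin_omega_words_iff]
  have *: "\<exists>n. \<forall>\<beta>. (\<forall>i. \<beta> i \<in> Y) \<and> (\<forall>i<n. \<beta> i = \<alpha> i) \<longrightarrow> \<beta> \<notin> K"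
    if "\<forall>i. \<alpha> i \<in> Y" "\<alpha> \<notin> K" for \<alpha>
    using bspec[OF compl, of \<alpha>] that by simp
  show "K = (\<Inter>n. G n)"
  proof (rule antisym)
    show "K \<subseteq> (\<Inter>n. G n)"
    proof (intro subsetI INT_I)
      fix \<alpha> n assume "\<alpha> \<in> K"
      with K show "\<alpha> \<in> G n"
        unfolding G_def by (intro CollectI conjI bexI[of _ \<alpha>]) auto
    qed
    show "(\<Inter>n. G n) \<subseteq> K"
    proof
      fix \<alpha> assume "\<alpha> \<in> (\<Inter>n. G n)"
      then have "\<forall>i. \<alpha> i \<in> Y" "\<And>n. \<exists>\<beta>\<in>K. \<forall>i<n. \<beta> i = \<alpha> i"
        unfolding G_def by blast+
      show "\<alpha> \<in> K"
      proof (rule ccontr)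
        assume "\<alpha> \<notin> K"
        from *[OF \<open>\<forall>i. \<alpha> i \<in> Y\<close> this] obtain n
          where n: "\<And>\<beta>. (\<forall>i. \<beta> i \<in> Y) \<and> (\<forall>i<n. \<beta> i = \<alpha> i) \<Longrightarrow> \<beta> \<notin> K" by blast
        obtain \<beta> where "\<beta> \<in> K" "\<forall>i<n. \<beta> i = \<alpha> i"
          using \<open>\<And>n. \<exists>\<beta>\<in>K. \<forall>i<n. \<beta> i = \<alpha> i\<close> by blast
        moreover from this K have "\<forall>i. \<beta> i \<in> Y" by auto
        ultimately show False using n[of \<beta>] by blast
      qed
    qed
  qed
qed

text \<open>In the intersection case level 1 lies below \<xi>, so open sets with intersection
  \<open>K\<close> can be interleaved with the given sets.\<close>

lemma Pi0_Int_closedin: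
  assumes "Pi0 (omega_words Y) \<xi> S" "closedin (omega_words Y) K"
  shows "Pi0 (omega_words Y) \<xi> (S \<inter> K)"
  using assms(1)
proof cases
  case Pi0_closed
  then show ?thesis
    using assms(2) by (intro Sigma0_Pi0.Pi0_closed) auto
next
  case (Pi0_Inter \<gamma> T)
  obtain G where G: "\<And>n. openin (omega_words Y) (G n)" "K = (\<Inter>n::nat. G n)"
    using closedin_omega_words_decomp[OF assms(2)] by metis
  have one: "ord_one <o \<xi>"
    using Sigma0_level(2)[OF assms(1)] Sigma0_level(1)[OF Pi0_Inter(3)]
      not_ordLess_one[OF Pi0_Inter(2)] by (intro ord_one_ordLess) blast+
  have "Pi0 (omega_words Y) \<xi> (\<Inter>n. if even n then T (n div 2) else G (n div 2))"
  proof (rule Sigma0_Pi0.Pi0_Inter[of "\<lambda>n. if even n then \<gamma> (n div 2) else ord_one"])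
    show "(if even n then \<gamma> (n div 2) else ord_one) <o \<xi>" for n
      using Pi0_Inter(2) one by simp
    have "Sigma0 (omega_words Y) ord_one (G n)" for n
      using G(1) Well_order_ord_one by (simp add: Sigma0_one_iff)
    then show "Sigma0 (omega_words Y) (if even n then \<gamma> (n div 2) else ord_one)
        (if even n then T (n div 2) else G (n div 2))" for n
      using Pi0_Inter(3) by simp
  qed
  also have "(\<Inter>n. if even n then T (n div 2) else G (n div 2)) = (\<Inter>n. T n) \<inter> (\<Inter>n. G n)"
    (is "(\<Inter>n. ?F n) = _")
  proof (intro equalityI subsetI)
    fix \<alpha> assume "\<alpha> \<in> (\<Inter>n. ?F n)"
    then have "\<alpha> \<in> ?F (2 * n)" "\<alpha> \<in> ?F (Suc (2 * n))" for n
      by (simp_all only: INT_iff UNIV_I)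
    then show "\<alpha> \<in> (\<Inter>n. T n) \<inter> (\<Inter>n. G n)"
      by simp
  qed auto
  also have "\<dots> = S \<inter> K"
    using Pi0_Inter(1) G(2) by simp
  finally show ?thesis .
qed

lemma Sigma0_Int_closedin:
  assumes "Sigma0 (omega_words Y) \<xi> S" "closedin (omega_words Y) K" "card (Field \<xi>) \<noteq> 1"
  shows "Sigma0 (omega_words Y) \<xi> (S \<inter> K)"
proof -
  obtain \<gamma> T where T: "\<And>n::nat. \<gamma> n <o \<xi>" "\<And>n. Pi0 (omega_words Y) (\<gamma> n) (T n)" "S = (\<Union>n. T n)"
    using Sigma0_Union_cases[OF assms(1,3)] by metis
  have "Sigma0 (omega_words Y) \<xi> (\<Union>n. T n \<inter> K)"
    by (rule Sigma0_Union[of \<gamma>, OF T(1) Pi0_Int_closedin[OF T(2) assms(2)]])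
  then show ?thesis
    by (simp add: T(3) Int_UN_distrib2)
qed

section \<open>Representation by transition systems\<close>

text \<open>All that is asked for is an infinite run through labels containing \<open>x\<close>,
  hence the greatest fixed point.\<close>

coinductive accepts :: "('s \<Rightarrow> 's \<Rightarrow> 'a set) \<Rightarrow> 'a \<Rightarrow> 's \<Rightarrow> bool"
  for U :: "'s \<Rightarrow> 's \<Rightarrow> 'a set" and x :: 'a where
  "x \<in> U p q \<Longrightarrow> accepts U x q \<Longrightarrow> accepts U x p"

text \<open>
  The sets accepted from all states, not only from the initial one, have to belong to the class since
  they all contribute to the \<open>\<omega>\<close>-power of the language that is built from the system.
\<close>

definition represented :: "'a topology \<Rightarrow> ('a set \<Rightarrow> bool) \<Rightarrow> 'a set \<Rightarrow> bool" where
  "represented X \<Gamma> B \<longleftrightarrow> (\<exists>(U :: nat \<Rightarrow> nat \<Rightarrow> 'a set) p.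
     (\<forall>q r. openin X (U q r)) \<and> (\<forall>q. \<Gamma> {x. accepts U x q}) \<and> B = {x. accepts U x p})"

text \<open>For renumbering states: all numbers of the same state behave alike, so runs lift along
  \<open>f\<close>.\<close>

lemma accepts_surj:
  assumes "surj f"
  shows "accepts (\<lambda>p q. U (f p) (f q)) x p \<longleftrightarrow> accepts U x (f p)"
proof
  assume "accepts (\<lambda>p q. U (f p) (f q)) x p"
  then show "accepts U x (f p)"
    by (coinduction arbitrary: p) (auto elim: accepts.cases)
next
  assume "accepts U x (f p)"
  then show "accepts (\<lambda>p q. U (f p) (f q)) x p"
  proof (coinduction arbitrary: p)
    case accepts
    then obtain q where "x \<in> U (f p) q" "accepts U x q"
      by (auto elim: accepts.cases)
    with surjD[OF assms, of q] show ?case by auto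
  qed
qed

lemma representedI:
  fixes U :: "'s::countable \<Rightarrow> 's \<Rightarrow> 'a set"
  assumes "\<And>q r. openin X (U q r)" "\<And>q. \<Gamma> {x. accepts U x q}" "B = {x. accepts U x p}"
  shows "represented X \<Gamma> B"
proof -
  have "surj (from_nat :: nat \<Rightarrow> 's)" by simp
  note * = accepts_surj[OF this, of U]
  show ?thesis
    unfolding represented_def
    by (rule exI[of _ "\<lambda>p q. U (from_nat p) (from_nat q)"], rule exI[of _ "to_nat p"])
      (simp add: * assms)
qed

text \<open>The state \<open>False\<close> tests membership in \<open>B\<close> once and moves to
  \<open>True\<close>, which loops forever. From \<open>True\<close> the whole space is accepted,
  hence the third assumption.\<close>

lemma represented_open:
  assumes "openin X B" "\<Gamma> B" "\<Gamma> (topspace X)"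
  shows "represented X \<Gamma> B"
proof -
  define U where "U p q = (if \<not> q then {} else if p then topspace X else B)" for p q
  have True: "accepts U x True \<longleftrightarrow> x \<in> topspace X" for x
  proof
    assume "x \<in> topspace X"
    then show "accepts U x True"
      by (coinduction) (auto simp: U_def)
  qed (auto elim: accepts.cases simp: U_def split: if_splits)
  have False: "accepts U x False \<longleftrightarrow> x \<in> B" for x
    using True openin_subset[OF assms(1)] 
    by (subst accepts.simps) (auto simp: U_def split: if_splits)
  show ?thesis
  proof (rule representedI[where U = U and p = False])
    show "openin X (U q r)" for q r
      using assms(1) by (auto simp: U_def)
    show "\<Gamma> {x. accepts U x q}" for q
      using assms by (cases q) (auto simp: True False)
  qed (auto simp: False)
qed

text \<open>State \<open>m\<close> tests \<open>G m\<close> and moves on to \<open>Suc m\<close>. A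
  late start skips tests, but by monotonicity the remaining ones imply them, so all states accept
  the same set.\<close>

lemma represented_decreasing_Inter:
  assumes "\<And>n. openin X (G n)" "decseq G" "\<Gamma> (\<Inter>n::nat. G n)"
  shows "represented X \<Gamma> (\<Inter>n. G n)"
proof -
  define U where "U m n = (if n = Suc m then G m else {})" for m n :: nat
  have acc: "accepts U x n \<longleftrightarrow> x \<in> (\<Inter>n. G n)" for x n
  proof
    assume "x \<in> (\<Inter>n. G n)"
    then show "accepts U x n"
      by (coinduction arbitrary: n) (auto simp: U_def)
  next
    assume "accepts U x n"
    then have "accepts U x (n + k)" for k
      by (induction k) (auto elim: accepts.cases simp: U_def split: if_splits)
    then have "x \<in> G (n + k)" for k
      by (metis accepts.cases U_def empty_iff)
    then have "x \<in> G k" for k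
      using decseqD[OF assms(2), of k "n + k"] by auto
    then show "x \<in> (\<Inter>n. G n)" by auto
  qed
  show ?thesis
  proof (rule representedI[where U = U and p = 0])
    show "openin X (U m n)" for m n
      using assms(1) by (simp add: U_def)
  qed (use assms(3) in \<open>simp_all only: acc Collect_mem_eq\<close>)
qed

text \<open>The fresh initial state \<open>None\<close> guesses an index \<open>n\<close> while it
  makes the first move of the \<open>n\<close>-th system; the run then stays in that component, so
  every other state accepts a set of some class \<Gamma>' n.\<close>

lemma represented_Union:
  fixes X :: "'a topology"
  assumes B: "\<And>n. represented X (\<Gamma>' n) (B n)" "\<And>n S. \<Gamma>' n S \<Longrightarrow> \<Gamma> S" "\<Gamma> (\<Union>n::nat. B n)"
  shows "represented X \<Gamma> (\<Union>n. B n)"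
proof -
  from B(1) obtain V :: "nat \<Rightarrow> nat \<Rightarrow> nat \<Rightarrow> 'a set" and p where V: "\<And>n q r. openin X (V n q r)" "\<And>n q. \<Gamma>' n {x. accepts (V n) x q}"
    "\<And>n. B n = {x. accepts (V n) x (p n)}"
    unfolding represented_def by metis
  define U :: "(nat \<times> nat) option \<Rightarrow> (nat \<times> nat) option \<Rightarrow> 'a set"
    where "U s t = (case t of None \<Rightarrow> {} | Some (n, r) \<Rightarrow>
      (case s of None \<Rightarrow> V n (p n) r | Some (m, q) \<Rightarrow> if m = n then V n q r else {}))" for s t
  have Some: "accepts U x (Some (n, q)) \<longleftrightarrow> accepts (V n) x q" for x n q
  proof
    assume "accepts U x (Some (n, q))"
    then show "accepts (V n) x q"
      by (coinduction arbitrary: q)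
        (erule accepts.cases, auto simp: U_def split: option.splits if_splits)
  next
    assume "accepts (V n) x q"
    then show "accepts U x (Some (n, q))"
    proof (coinduction arbitrary: q)
      case accepts
      then obtain r where "x \<in> V n q r" "accepts (V n) x r" by (auto elim: accepts.cases)
      then show ?case
        by (intro exI[of _ "Some (n, q)"] exI[of _ "Some (n, r)"]) (auto simp: U_def)
    qed
  qed
  have None: "accepts U x None \<longleftrightarrow> x \<in> (\<Union>n. B n)" for x
  proof
    assume "accepts U x None"
    then obtain n r where "x \<in> V n (p n) r" "accepts U x (Some (n, r))"
      by (cases rule: accepts.cases) (auto simp: U_def split: option.splits)
    then show "x \<in> (\<Union>n. B n)"
      by (auto simp: V(3) Some intro: accepts.intros)
  next
    assume "x \<in> (\<Union>n. B n)"
    then obtain n where "accepts (V n) x (p n)"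
      by (auto simp: V(3))
    then obtain r where "x \<in> V n (p n) r" "accepts (V n) x r"
      by (auto elim: accepts.cases)
    then show "accepts U x None"
      by (intro accepts.intros[of x U None "Some (n, r)"]) (auto simp: Some U_def)
  qed
  show ?thesis
  proof (rule representedI[where U = U and p = None])
    show "openin X (U s t)" for s t
      by (auto simp: U_def V(1) split: option.splits)
    show "\<Gamma> {x. accepts U x s}" for s
    proof (cases s)
      case None
      then show ?thesis
        using B(3) by (simp only: \<open>\<And>x. accepts U x None \<longleftrightarrow> x \<in> (\<Union>n. B n)\<close> Collect_mem_eq)
    next
      case (Some nq)
      then show ?thesis
        using B(2)[OF V(2)] \<open>\<And>x n q. accepts U x (Some (n, q)) \<longleftrightarrow> accepts (V n) x q\<close>
        by (cases nq) simp
    qed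
  qed (simp only: None Collect_mem_eq)
qed

text \<open>
  The system for an intersection runs the \<open>n\<close>-th component from step \<open>n\<close> on; a state lists the
  current states of the components that are already running.
\<close>

lemma represented_Inter:
  fixes X :: "'a topology"
  assumes B: "\<And>n. represented X (\<Gamma>' n) (B n)"
    and \<Gamma>: "\<And>S. (\<And>n::nat. \<Gamma>' n (S n)) \<Longrightarrow> \<Gamma> (\<Inter>n. S n)"
  shows "represented X \<Gamma> (\<Inter>n. B n)"
proof -
  from B(1) obtain V :: "nat \<Rightarrow> nat \<Rightarrow> nat \<Rightarrow> 'a set" and p where V: "\<And>n q r. openin X (V n q r)" "\<And>n q. \<Gamma>' n {x. accepts (V n) x q}"
    "\<And>n. B n = {x. accepts (V n) x (p n)}"
    unfolding represented_def by metis
  \<comment> \<open>A component that is not running yet counts as waiting in its initial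
    state.\<close>
  define st where "st qs n = (if n < length qs then qs ! n else p n)" for qs n
  \<comment> \<open>All running components move at once and one more is started. The factor
    \<open>topspace X\<close> matters for empty \<open>qs\<close>, where the intersection over no
    index would be everything.\<close>
  define U where "U qs rs = (if length rs = Suc (length qs) \<and> rs ! length qs = p (length qs)
      then topspace X \<inter> (\<Inter>i\<in>{..<length qs}. V i (qs ! i) (rs ! i)) else {})" for qs rs
  have step: "\<exists>rs. accepts U x rs \<and> length rs = Suc (length qs) \<and> rs ! length qs = p (length qs) \<and>
      (\<forall>i<length qs. x \<in> V i (qs ! i) (rs ! i))" if "accepts U x qs" for x qs
    using that by cases (auto simp: U_def split: if_splits)
  have acc: "accepts U x qs \<longleftrightarrow> x \<in> topspace X \<and> (\<forall>n. accepts (V n) x (st qs n))" for x qs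
  proof
    assume qs: "accepts U x qs"
    have run: "accepts (V n) x (rs ! n)" if "accepts U x rs" "n < length rs" for rs n
      using that
    proof (coinduction arbitrary: rs)
      case accepts
      then show ?case using step[of x rs] by (metis less_Suc_eq)
    qed
    have "accepts (V n) x (st qs n)" for n
      using qs
    \<comment> \<open>Induction on the number of steps until component \<open>n\<close> is
      running.\<close>
    proof (induction "Suc n - length qs" arbitrary: qs)
      case 0
      then show ?case using run by (auto simp: st_def)
    next
      case (Suc k)
      obtain rs where rs: "accepts U x rs" "length rs = Suc (length qs)" "rs ! length qs = p (length qs)"
        using step[OF Suc(3)] by blast
      have "accepts (V n) x (st rs n)"
        by (rule Suc(1)) (use rs Suc(2) in auto)
      then show ?case
        using rs Suc(2) by (auto simp: st_def less_Suc_eq split: if_splits)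
    qed
    moreover have "x \<in> topspace X"
      using qs by cases (auto simp: U_def split: if_splits)
    ultimately show "x \<in> topspace X \<and> (\<forall>n. accepts (V n) x (st qs n))" by blast
  next
    assume *: "x \<in> topspace X \<and> (\<forall>n. accepts (V n) x (st qs n))"
    then show "accepts U x qs"
    proof (coinduction arbitrary: qs)
      case accepts
      then have "\<exists>r. x \<in> V n (st qs n) r \<and> accepts (V n) x r" for n
        by (meson accepts.cases)
      then obtain f where f: "\<And>n. x \<in> V n (st qs n) (f n)" "\<And>n. accepts (V n) x (f n)"
        by metis
      \<comment> \<open>Running components follow the chosen successors; the component that is just
        started has made no move.\<close>
      define rs where "rs = map f [0..<length qs] @ [p (length qs)]"
      have rs_end: "length rs = Suc (length qs)" "rs ! length qs = p (length qs)"
        by (simp_all add: rs_def nth_append)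
      have "x \<in> V i (qs ! i) (rs ! i)" if "i < length qs" for i
        using f(1)[of i] that by (simp add: rs_def nth_append st_def)
      then have "x \<in> U qs rs"
        using accepts rs_end by (simp add: U_def)
      moreover have "st rs n = (if n < length qs then f n else st qs n)" for n
        by (auto simp: rs_def nth_append st_def not_less less_Suc_eq)
      then have "accepts (V n) x (st rs n)" for n
        using f(2) accepts by simp
      ultimately show ?case
        using accepts by (intro exI[of _ qs] exI[of _ rs] conjI refl disjI1) simp_all
    qed
  qed
  have top: "{x. accepts (V n) x q} \<subseteq> topspace X" for n q
  proof
    fix x assume "x \<in> {x. accepts (V n) x q}"
    then obtain r where "x \<in> V n q r"
      by (auto elim: accepts.cases)
    with openin_subset[OF V(1)] show "x \<in> topspace X" by blast
  qed
  have eq: "{x. accepts U x qs} = (\<Inter>n. {x. accepts (V n) x (st qs n)})" for qs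
    using top[of 0 "st qs 0"] by (auto simp: acc)
  show ?thesis
  proof (rule representedI[where U = U and p = "[]"])
    show "openin X (U qs rs)" for qs rs
      unfolding U_def by (auto intro!: openin_Int_Inter V(1)) 
    show "\<Gamma> {x. accepts U x qs}" for qs
      unfolding eq by (rule \<Gamma>) (rule V(2))
    show "(\<Inter>n. B n) = {x. accepts U x []}"
      unfolding eq by (simp add: V(3) st_def)
  qed
qed

text \<open>In a union the states accept sets of lower levels, which are lifted to \<xi>; in an
  intersection each state accepts an intersection of such sets, one for each component.\<close>

theorem Sigma0_represented:
  "Sigma0 (omega_words Y) \<xi> B \<Longrightarrow> represented (omega_words Y) (Sigma0 (omega_words Y) \<xi>) B"
  "Pi0 (omega_words Y) \<xi> B \<Longrightarrow> represented (omega_words Y) (Pi0 (omega_words Y) \<xi>) B"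
proof (induction rule: Sigma0_Pi0.inducts)
  case (Sigma0_open \<xi> S)
  then show ?case
    by (intro represented_open) (auto simp: Sigma0_one_iff simp del: topspace_omega_words)
next
  case (Pi0_closed \<xi> S)
  then obtain G where "\<And>n. openin (omega_words Y) (G n)" "decseq G" "S = (\<Inter>n::nat. G n)"
    using closedin_omega_words_decomp by metis
  with Pi0_closed show ?case
    using represented_decreasing_Inter[of "omega_words Y" G] by (simp add: Sigma0_one_iff)
next
  case (Sigma0_Union \<gamma> \<xi> S)
  show ?case
    by (rule represented_Union[OF Sigma0_Union(3)])
      (use Sigma0_Union in \<open>blast intro: Pi0_imp_Sigma0 Sigma0_Pi0.Sigma0_Union\<close>)+
next
  case (Pi0_Inter \<gamma> \<xi> S)
  show ?case
    by (rule represented_Inter[OF Pi0_Inter(3)])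
      (use Pi0_Inter in \<open>blast intro: Sigma0_Pi0.Pi0_Inter\<close>)
qed

section \<open>Factorizations of infinite words\<close>

text \<open>Splits off the first factor, which may be empty, so \<open>k\<close> may be 0.\<close>

lemma omega_powerD:
  assumes "\<alpha> \<in> omega_power V"
  shows "\<exists>k. prefix k \<alpha> \<in> V \<and> suffix k \<alpha> \<in> omega_power V"
proof -
  from assms obtain u where u: "\<And>i. u i \<in> V"
    "\<And>n k. k < length (concat (map u [0..<n])) \<Longrightarrow> concat (map u [0..<n]) ! k = \<alpha> k"
    "\<And>m. \<exists>n. m \<le> length (concat (map u [0..<n]))"
    unfolding omega_power_def Let_def by blast
  have Suc: "concat (map u [0..<Suc n]) = u 0 @ concat (map (u \<circ> Suc) [0..<n])" for n
    by (subst upt_conv_Cons) (simp_all add: map_Suc_upt[symmetric] del: upt_Suc)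
  have "prefix (length (u 0)) \<alpha> = u 0"
    using u(2)[of _ 1] by (intro nth_equalityI) simp_all
  with u(1) have "prefix (length (u 0)) \<alpha> \<in> V" by simp
  moreover have "suffix (length (u 0)) \<alpha> \<in> omega_power V"
    unfolding omega_power_def Let_def
  proof (intro CollectI exI[of _ "u \<circ> Suc"] conjI allI impI)
    show "(u \<circ> Suc) i \<in> V" for i
      by (simp add: u(1))
    fix n k assume "k < length (concat (map (u \<circ> Suc) [0..<n]))"
    then show "concat (map (u \<circ> Suc) [0..<n]) ! k = suffix (length (u 0)) \<alpha> k"
      using u(2)[of "length (u 0) + k" "Suc n"] unfolding Suc by (simp add: nth_append)
  next
    fix m
    obtain n where n: "length (u 0) + m \<le> length (concat (map u [0..<n]))"
      using u(3) by blast
    show "\<exists>n. m \<le> length (concat (map (u \<circ> Suc) [0..<n]))"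
    proof (cases n)
      case 0
      with n show ?thesis by simp
    next
      case (Suc n')
      with n show ?thesis
        by (intro exI[of _ n']) (simp only: Suc length_append \<open>\<And>n. concat (map u [0..<Suc n]) = u 0 @ concat (map (u \<circ> Suc) [0..<n])\<close>)
    qed
  qed
  ultimately show ?thesis by blast
qed

text \<open>Choosing a first factor again and again yields a factorization, with \<open>a n\<close>
  the rest after \<open>n\<close> factors. As the factors are non-empty, the partial concatenations
  become arbitrarily long.\<close>

lemma omega_power_coinduct:
  assumes "\<alpha> \<in> S"
    and S: "\<And>\<beta>. \<beta> \<in> S \<Longrightarrow> \<exists>k>0. prefix k \<beta> \<in> V \<and> suffix k \<beta> \<in> S"
  shows "\<alpha> \<in> omega_power V"
proof -
  obtain f where f: "\<And>\<beta>. \<beta> \<in> S \<Longrightarrow> 0 < f \<beta> \<and> prefix (f \<beta>) \<beta> \<in> V \<and> suffix (f \<beta>) \<beta> \<in> S"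
    using S by metis
  define a where "a = rec_nat \<alpha> (\<lambda>_ \<beta>. suffix (f \<beta>) \<beta>)"
  define u where "u n = prefix (f (a n)) (a n)" for n
  have a_simps: "a 0 = \<alpha>" "a (Suc n) = suffix (f (a n)) (a n)" for n
    by (simp_all add: a_def)
  have aS: "a n \<in> S" for n
  proof (induction n)
    case 0
    show ?case using assms(1) by (simp only: a_simps(1))
  next
    case (Suc n)
    show ?case using f[OF Suc] by (simp only: a_simps(2))
  qed
  have \<alpha>: "\<alpha> = concat (map u [0..<n]) \<frown> a n" for n
  proof (induction n)
    case (Suc n)
    have "a n = u n \<frown> a (Suc n)"
      unfolding u_def a_simps(2) by (rule prefix_suffix)
    then show ?case
      using Suc by simp
  qed (simp add: a_simps)
  have "n \<le> length (concat (map u [0..<n]))" for n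
  proof (induction n)
    case (Suc n)
    have "1 \<le> length (u n)"
      using f[OF aS, of n] by (simp add: u_def Suc_le_eq)
    with Suc show ?case by (simp del: length_greater_0_conv add: Suc_le_eq)
  qed simp
  moreover have "concat (map u [0..<n]) ! k = \<alpha> k" if "k < length (concat (map u [0..<n]))" for n k
    using conc_fst[OF that, of "a n"] \<alpha>[of n] by simp
  moreover have "u n \<in> V" for n
    using f[OF aS] by (simp add: u_def)
  ultimately show ?thesis
    unfolding omega_power_def Let_def by (intro CollectI exI[of _ u] conjI allI impI) auto
qed

lemma omega_power_letters:
  assumes "\<alpha> \<in> omega_power V"
  shows "\<alpha> k \<in> (\<Union>u\<in>V. set u)"
proof -
  from assms obtain u where u: "\<And>i. u i \<in> V"
    "\<And>n k. k < length (concat (map u [0..<n])) \<Longrightarrow> concat (map u [0..<n]) ! k = \<alpha> k"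
    "\<And>m. \<exists>n. m \<le> length (concat (map u [0..<n]))"
    unfolding omega_power_def Let_def by blast
  from u(3)[of "Suc k"] obtain n where n: "k < length (concat (map u [0..<n]))"
    by (auto simp: Suc_le_eq)
  have "\<alpha> k \<in> set (concat (map u [0..<n]))"
    using nth_mem[OF n] u(2)[OF n] by simp
  with u(1) show ?thesis by auto
qed

text \<open>
  Every position of a word is followed closely by one where the rest starts with \<open>False\<close> or with
  \<open>True, True\<close>, so a word can be cut into words of these two kinds from anywhere on.
\<close>

lemma omega_power_absorbing:
  assumes F: "\<And>u. u \<noteq> [] \<Longrightarrow> \<not> hd u \<Longrightarrow> u \<in> V"
    and TT: "\<And>u. 2 \<le> length u \<Longrightarrow> u ! 0 \<Longrightarrow> u ! 1 \<Longrightarrow> u \<in> V"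
    and \<alpha>: "\<And>m. k \<le> m \<Longrightarrow> prefix m \<alpha> \<in> V"
  shows "\<alpha> \<in> omega_power V"
\<comment> \<open>The invariant says that all long prefixes are in \<open>V\<close>, so that the
  next cut can be postponed to a convenient place.\<close>
proof (rule omega_power_coinduct[of _ "{\<alpha>. \<exists>k. \<forall>m\<ge>k. prefix m \<alpha> \<in> V}"])
  show "\<alpha> \<in> {\<alpha>. \<exists>k. \<forall>m\<ge>k. prefix m \<alpha> \<in> V}"
    using \<alpha> by blast
  fix \<beta> :: "nat \<Rightarrow> bool" assume "\<beta> \<in> {\<alpha>. \<exists>k. \<forall>m\<ge>k. prefix m \<alpha> \<in> V}"
  then obtain k where k: "\<And>m. k \<le> m \<Longrightarrow> prefix m \<beta> \<in> V" by blast
  define l where "l = Suc k"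
  \<comment> \<open>If \<open>True\<close>, \<open>False\<close> is read at \<open>l\<close>, the
    cut moves on to that \<open>False\<close>; otherwise the rest from \<open>l\<close> is already
    of one of the two kinds.\<close>
  define m where "m = (if \<beta> l \<and> \<not> \<beta> (Suc l) then Suc l else l)"
  have "0 < m" "k \<le> m"
    by (simp_all add: m_def l_def)
  have "prefix i (suffix m \<beta>) \<in> V" if "2 \<le> i" for i
  proof (cases "\<beta> m")
    case True
    then have "\<beta> (Suc m)"
      by (auto simp: m_def split: if_splits)
    with True that show ?thesis
      by (intro TT) simp_all
  next
    case False
    with that show ?thesis
      by (intro F) (simp_all add: hd_conv_nth del: subsequence_shift)
  qed
  with k[OF \<open>k \<le> m\<close>] \<open>0 < m\<close>
  show "\<exists>k>0. prefix k \<beta> \<in> V \<and> suffix k \<beta> \<in> {\<alpha>. \<exists>k. \<forall>m\<ge>k. prefix m \<alpha> \<in> V}"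
    by blast
qed

section \<open>The coding of infinite words\<close>

text \<open>
  The first block of a code determines its level \<open>n\<close>, so that a cut in front of a block carries a
  memory. Every block repeats the whole prefix read so far, since the condition of a transition to
  level \<open>m\<close> concerns \<open>prefix m \<beta>\<close> and not only the letters after the previous cut.
\<close>

definition block :: "bool list \<Rightarrow> bool list" where
  "block w = True # replicate (length w) False @ True # w"

definition blocks :: "(nat \<Rightarrow> bool) \<Rightarrow> nat \<Rightarrow> nat \<Rightarrow> bool list" where
  "blocks \<beta> n m = concat (map (\<lambda>i. block (prefix (Suc i) \<beta>)) [n..<m])"

text \<open>The infinite concatenation of all blocks from index \<open>n\<close> on; blocks are
  non-empty, so the first \<open>k + 1\<close> of them cover position \<open>k\<close>.\<close>

definition code :: "nat \<Rightarrow> (nat \<Rightarrow> bool) \<Rightarrow> nat \<Rightarrow> bool" where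
  "code n \<beta> k = blocks \<beta> n (Suc (n + k)) ! k"

lemma length_block [simp]: "length (block w) = 2 * length w + 2"
  by (simp add: block_def)

lemma length_blocks: "length (blocks \<beta> n m) = (\<Sum>i\<leftarrow>[n..<m]. 2 * i + 4)"
  by (simp add: blocks_def length_concat comp_def eval_nat_numeral)

text \<open>Cut positions thus depend on the levels alone and not on the word that is coded.\<close>

lemma length_blocks_cong: "length (blocks \<beta> n m) = length (blocks \<gamma> n m)"
  by (simp add: length_blocks)

lemma length_blocks_ge: "m - n \<le> length (blocks \<beta> n m)"
  unfolding length_blocks by (induction m) auto

lemma blocks_append: "n \<le> m \<Longrightarrow> m \<le> l \<Longrightarrow> blocks \<beta> n l = blocks \<beta> n m @ blocks \<beta> m l"
  using upt_add_eq_append[of n m "l - m"] by (simp add: blocks_def)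

lemma blocks_Suc: "n \<le> m \<Longrightarrow> blocks \<beta> n (Suc m) = blocks \<beta> n m @ block (prefix (Suc m) \<beta>)"
  by (simp add: blocks_def)

lemma blocks_cong:
  assumes "prefix m \<beta> = prefix m \<gamma>"
  shows "blocks \<beta> n m = blocks \<gamma> n m"
proof -
  have "prefix (Suc i) \<beta> = prefix (Suc i) \<gamma>" if "i < m" for i
    using arg_cong[OF assms, of "take (Suc i)"] that by simp
  then show ?thesis
    unfolding blocks_def by (intro arg_cong[of _ _ concat] map_cong) auto
qed

text \<open>The last block contains the whole prefix of length \<open>m\<close>.\<close>

lemma blocks_inj:
  assumes "n < m" "blocks \<beta> n m = blocks \<gamma> n m"
  shows "prefix m \<beta> = prefix m \<gamma>"
proof -
  obtain l where l: "m = Suc l" "n \<le> l"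
    using assms(1) by (cases m) auto
  then have "block (prefix m \<beta>) = block (prefix m \<gamma>)"
    using assms(2) length_blocks_cong[of \<beta> n l \<gamma>] by (simp add: blocks_Suc)
  then show ?thesis
    by (simp add: block_def)
qed

lemma nth_blocks_cong:
  assumes "k < length (blocks \<beta> n m)" "k < length (blocks \<beta> n l)"
  shows "blocks \<beta> n m ! k = blocks \<beta> n l ! k"
proof -
  have *: "blocks \<beta> n m ! k = blocks \<beta> n l ! k" if "m \<le> l" "k < length (blocks \<beta> n m)" for m l
  proof -
    have "n \<le> m"
      using that(2) by (cases "n \<le> m") (auto simp: blocks_def)
    then show ?thesis
      using that by (simp add: blocks_append[of n m l] nth_append)
  qed
  show ?thesis
  proof (cases "m \<le> l")
    case True
    then show ?thesis using *[OF _ assms(1)] by simp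
  next
    case False
    then show ?thesis using *[OF _ assms(2), of m] by simp
  qed
qed

lemma code_conc:
  assumes "n \<le> m"
  shows "code n \<beta> = blocks \<beta> n m \<frown> code m \<beta>"
proof
  fix k
  let ?l = "length (blocks \<beta> n m)"
  have k: "k < length (blocks \<beta> n (Suc (n + k)))"
    using length_blocks_ge[of "Suc (n + k)" n \<beta>] by simp
  show "code n \<beta> k = (blocks \<beta> n m \<frown> code m \<beta>) k"
  proof (cases "k < ?l")
    case True
    then show ?thesis
      using nth_blocks_cong[OF True k] by (simp add: code_def)
  next
    case False
    have split: "blocks \<beta> n (Suc (m + (k - ?l))) = blocks \<beta> n m @ blocks \<beta> m (Suc (m + (k - ?l)))"
      using assms by (intro blocks_append) auto
    have "k < length (blocks \<beta> n (Suc (m + (k - ?l))))"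
      unfolding split using length_blocks_ge[of "Suc (m + (k - ?l))" m \<beta>] by simp
    with k have "code n \<beta> k = blocks \<beta> n (Suc (m + (k - ?l))) ! k"
      unfolding code_def by (intro nth_blocks_cong)
    then show ?thesis
      unfolding split using False by (simp add: nth_append code_def)
  qed
qed

lemma prefix_code: "n \<le> m \<Longrightarrow> prefix (length (blocks \<beta> n m)) (code n \<beta>) = blocks \<beta> n m"
  by (simp add: code_conc[of n m])

lemma suffix_code: "n \<le> m \<Longrightarrow> suffix (length (blocks \<beta> n m)) (code n \<beta>) = code m \<beta>"
  by (simp add: code_conc[of n m])

lemma code_block: "code n \<beta> = block (prefix (Suc n) \<beta>) \<frown> code (Suc n) \<beta>"
  using code_conc[of n "Suc n" \<beta>] by (simp add: blocks_def)

lemma code_head: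
  "code n \<beta> 0" "0 < k \<Longrightarrow> k \<le> Suc n \<Longrightarrow> \<not> code n \<beta> k" "code n \<beta> (Suc (Suc n))"
proof -
  have nth: "code n \<beta> i = block (prefix (Suc n) \<beta>) ! i" if "i \<le> Suc (Suc n)" for i
    using that by (subst code_block, subst conc_fst) auto
  show "code n \<beta> 0" "code n \<beta> (Suc (Suc n))"
    by (simp_all add: nth block_def nth_append)
  assume "0 < k" "k \<le> Suc n"
  then show "\<not> code n \<beta> k"
    by (cases k) (simp_all add: nth block_def nth_append del: replicate.simps)
qed

lemma code_cong:
  "prefix (Suc (n + k)) \<beta> = prefix (Suc (n + k)) \<gamma> \<Longrightarrow> code n \<beta> k = code n \<gamma> k"
  unfolding code_def using blocks_cong[of \<beta> "Suc (n + k)" \<gamma> n] by simp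

text \<open>The second \<open>True\<close> of a code from level \<open>n\<close> stands at position
  \<open>n + 2\<close>, where a code from a larger level still has \<open>False\<close>.\<close>

lemma code_level_unique:
  assumes "code n \<beta> (Suc (Suc n)) = code m \<gamma> (Suc (Suc n))"
    "code n \<beta> (Suc (Suc m)) = code m \<gamma> (Suc (Suc m))"
  shows "n = m"
  using assms code_head(2)[of "Suc (Suc n)" m \<gamma>] code_head(2)[of "Suc (Suc m)" n \<beta>]
    code_head(3)[of n \<beta>] code_head(3)[of m \<gamma>]
  by (cases n m rule: linorder_cases) auto

text \<open>Letter \<open>i\<close> is read in the first block that contains it, that of index
  \<open>max i n\<close>, behind its \<open>max i n + 3\<close> marker letters. Since block lengths
  do not depend on the word, \<open>undefined\<close> can stand for it.\<close>

definition decode :: "nat \<Rightarrow> (nat \<Rightarrow> bool) \<Rightarrow> nat \<Rightarrow> bool" where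
  "decode n \<alpha> i = \<alpha> (length (blocks undefined n (max i n)) + (max i n + 3 + i))"

lemma decode_code [simp]: "decode n (code n \<beta>) = \<beta>"
proof
  fix i
  let ?m = "max i n"
  have "decode n (code n \<beta>) i = code ?m \<beta> (?m + 3 + i)"
    unfolding decode_def length_blocks_cong[of undefined n ?m \<beta>]
    by (subst code_conc[of n ?m]) simp_all
  also have "\<dots> = block (prefix (Suc ?m) \<beta>) ! (?m + 3 + i)"
    unfolding code_block[of ?m] by (subst conc_fst) auto
  also have "\<dots> = \<beta> i"
    by (simp add: block_def nth_append numeral_eq_Suc)
  finally show "decode n (code n \<beta>) i = \<beta> i" .
qed

lemma prefix_eq_iff: "prefix k \<alpha> = prefix k \<beta> \<longleftrightarrow> (\<forall>i<k. \<alpha> i = \<beta> i)"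
  by (auto simp: list_eq_iff_nth_eq)

lemma continuous_map_code: "continuous_map (omega_words UNIV) (omega_words UNIV) (code n)"
proof (rule continuous_map_omega_words_finite_dep)
  fix k
  have "prefix (Suc (n + k)) \<gamma> = prefix (Suc (n + k)) \<beta>" if "\<forall>j<Suc (n + k). \<gamma> j = \<beta> j"
    for \<beta> \<gamma> :: "nat \<Rightarrow> bool"
    using that by (simp only: prefix_eq_iff)
  then show "\<exists>m. \<forall>\<beta> \<gamma>. (\<forall>j. \<beta> j \<in> UNIV) \<longrightarrow> (\<forall>j. \<gamma> j \<in> UNIV) \<longrightarrow> (\<forall>j<m. \<gamma> j = \<beta> j) \<longrightarrow>
      code n \<gamma> k = code n \<beta> k"
    by (intro exI[of _ "Suc (n + k)"] allI impI code_cong)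
qed

lemma continuous_map_decode: "continuous_map (omega_words UNIV) (omega_words UNIV) (decode n)"
proof -
  have "decode n = (\<lambda>\<alpha> i. \<alpha> (length (blocks undefined n (max i n)) + (max i n + 3 + i)))"
    by (simp add: fun_eq_iff decode_def)
  then show ?thesis
    by (simp only: continuous_map_omega_words_reindex)
qed

lemma Hausdorff_space_omega_words: "Hausdorff_space (omega_words Y)"
  unfolding omega_words_def by (simp add: Hausdorff_space_product_topology Hausdorff_space_discrete_topology)

text \<open>The range is the set where \<open>code n \<circ> decode n\<close> and the identity
  agree, two continuous maps into a Hausdorff space.\<close>

lemma closedin_range_code: "closedin (omega_words UNIV) (range (code n))"
proof -
  have "closedin (omega_words UNIV) {\<alpha> \<in> topspace (omega_words UNIV). (code n \<circ> decode n) \<alpha> = id \<alpha>}"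
    by (intro closedin_continuous_maps_eq[OF Hausdorff_space_omega_words[of "UNIV :: bool set"]]
        continuous_map_compose[OF continuous_map_decode continuous_map_code] continuous_map_id)
  also have "{\<alpha> \<in> topspace (omega_words UNIV). (code n \<circ> decode n) \<alpha> = id \<alpha>} = range (code n)"
  proof (intro equalityI subsetI)
    fix \<alpha> assume "\<alpha> \<in> {\<alpha> \<in> topspace (omega_words UNIV). (code n \<circ> decode n) \<alpha> = id \<alpha>}"
    then have "\<alpha> = code n (decode n \<alpha>)" by simp
    then show "\<alpha> \<in> range (code n)" by (metis rangeI)
  qed auto
  finally show ?thesis .
qed

section \<open>Prefixes and limits of codes\<close>

text \<open>The only word that is a limit of codes from unboundedly many levels is \<open>1 0 0 \<dots>\<close>.\<close>

definition unary_limit :: "nat \<Rightarrow> bool" where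
  "unary_limit = (\<lambda>i. i = 0)"

definition uncoded :: "bool list \<Rightarrow> bool" where
  "uncoded u \<longleftrightarrow> (\<forall>n \<beta>. prefix (length u) (code n \<beta>) \<noteq> u)"

lemma uncoded_prefix_iff: "uncoded (prefix k \<alpha>) \<longleftrightarrow> (\<forall>n \<beta>. \<exists>i<k. code n \<beta> i \<noteq> \<alpha> i)"
  by (simp add: uncoded_def prefix_eq_iff)

lemma uncoded_prefix_mono: "uncoded (prefix k \<alpha>) \<Longrightarrow> k \<le> m \<Longrightarrow> uncoded (prefix m \<alpha>)"
  unfolding uncoded_prefix_iff by (meson less_le_trans)

lemma not_uncoded_code: "\<not> uncoded (prefix k (code n \<beta>))"
  unfolding uncoded_prefix_iff by blast

text \<open>Codes from level \<open>k\<close> start with \<open>True\<close> followed by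
  \<open>k + 1\<close> times \<open>False\<close>.\<close>

lemma not_uncoded_unary_limit: "\<not> uncoded (prefix k unary_limit)"
proof -
  have "code k \<beta> i = unary_limit i" if "i < k" for i \<beta>
    using code_head(1)[of k \<beta>] code_head(2)[of i k \<beta>] that by (cases "i = 0") (auto simp: unary_limit_def)
  then show ?thesis
    unfolding uncoded_prefix_iff by blast
qed

text \<open>Codes start with \<open>True\<close>, \<open>False\<close>. This lemma and the next
  provide the two kinds of words needed for absorption.\<close>

lemma uncoded_False:
  assumes "u \<noteq> []" "\<not> hd u"
  shows "uncoded u"
  unfolding uncoded_def
proof (intro allI notI)
  fix n \<beta> assume "prefix (length u) (code n \<beta>) = u"
  then have "code n \<beta> 0 = u ! 0"
    using assms(1) by (metis add_0 length_greater_0_conv diff_zero subsequence_nth)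
  with assms code_head(1)[of n \<beta>] show False
    by (simp add: hd_conv_nth)
qed

lemma uncoded_True_True:
  assumes "2 \<le> length u" "u ! 0" "u ! 1"
  shows "uncoded u"
  unfolding uncoded_def
proof (intro allI notI)
  fix n \<beta> assume "prefix (length u) (code n \<beta>) = u"
  then have "code n \<beta> 1 = u ! 1"
    using assms(1) subsequence_nth[of 1 "length u" 0 "code n \<beta>"] by simp
  with assms code_head(2)[of 1 n \<beta>] show False
    by simp
qed

text \<open>Suppose all prefixes of \<alpha> are prefixes of codes. If \<alpha> has a second
  \<open>True\<close>, this fixes the level of the codes, and decoding at that level recovers
  \<alpha>; otherwise \<alpha> is the unary limit.\<close>

lemma uncoded_unary_limit_or_code:
  "(\<exists>k. uncoded (prefix k \<alpha>)) \<or> \<alpha> = unary_limit \<or> (\<exists>n. \<alpha> \<in> range (code n))"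
proof (rule ccontr)
  assume contr: "\<not> ?thesis"
  then have agree: "\<exists>n \<beta>. \<forall>i<k. code n \<beta> i = \<alpha> i" for k
    unfolding uncoded_prefix_iff by blast
  have "\<alpha> 0"
    using agree[of 1] code_head(1) by auto
  moreover from contr obtain j where "\<alpha> j \<noteq> unary_limit j"
    by (auto simp: fun_eq_iff)
  ultimately have "0 < j" "\<alpha> j"
    by (auto simp: unary_limit_def intro: gr0I split: if_splits)
  have *: "(0 < i \<and> i \<le> Suc n \<longrightarrow> \<not> \<alpha> i) \<and> (i = Suc (Suc n) \<longrightarrow> \<alpha> i)"
    if "\<forall>i<k. code n \<beta> i = \<alpha> i" "i < k" for n k i \<beta>
    using that code_head(2)[of i n \<beta>] code_head(3)[of n \<beta>] by auto
  obtain n \<beta> where n: "\<forall>i<Suc j. code n \<beta> i = \<alpha> i"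
    using agree by blast
  then have "Suc (Suc n) \<le> j"
    using *[OF n, of j] \<open>0 < j\<close> \<open>\<alpha> j\<close> by auto
  \<comment> \<open>A code that agrees with \<alpha> up to the \<open>True\<close> at
    \<open>j\<close> has its second \<open>True\<close> at or before \<open>j\<close>, so this range
    determines its level.\<close>
  have level: "m = n" if "\<forall>i<k. code m \<gamma> i = \<alpha> i" "Suc j \<le> k" for k m \<gamma>
  proof -
    have "code m \<gamma> i = code n \<beta> i" if "i \<le> j" for i
      using n \<open>\<forall>i<k. code m \<gamma> i = \<alpha> i\<close> \<open>Suc j \<le> k\<close> that by simp
    moreover have "Suc (Suc m) \<le> j"
      using *[OF that(1), of j] that(2) \<open>0 < j\<close> \<open>\<alpha> j\<close> by auto
    ultimately show ?thesis
      using \<open>Suc (Suc n) \<le> j\<close> by (intro code_level_unique[of m \<gamma> n \<beta>]) simp_all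
  qed
  define pos where "pos i = length (blocks undefined n (max i n)) + (max i n + 3 + i)" for i
  have "code n (decode n \<alpha>) k = \<alpha> k" for k
  proof -
    \<comment> \<open>Beyond \<open>j\<close>, to fix the level, beyond \<open>k\<close>, and beyond
      all positions read when decoding the first \<open>n + k + 1\<close> letters, which determine
      letter \<open>k\<close> of the code.\<close>
    define K where "K = Suc (j + k + (\<Sum>i<Suc (n + k). pos i))"
    obtain m \<gamma> where m: "\<forall>i<K. code m \<gamma> i = \<alpha> i"
      using agree by blast
    have "m = n"
      by (rule level[OF m]) (simp add: K_def)
    have "decode n \<alpha> i = \<gamma> i" if "i < Suc (n + k)" for i
    proof -
      have "pos i \<le> (\<Sum>i<Suc (n + k). pos i)"
        using that by (intro member_le_sum) auto
      then have "pos i < K"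
        by (simp add: K_def)
      then have "decode n \<alpha> i = decode n (code n \<gamma>) i"
        using m \<open>m = n\<close> unfolding decode_def pos_def[symmetric] by simp
      then show ?thesis by simp
    qed
    then have "code n (decode n \<alpha>) k = code n \<gamma> k"
      by (intro code_cong) (simp only: prefix_eq_iff, blast)
    also have "\<dots> = \<alpha> k"
      using m \<open>m = n\<close> by (simp add: K_def)
    finally show ?thesis .
  qed
  then have "\<alpha> = code n (decode n \<alpha>)"
    by (simp add: fun_eq_iff)
  with contr show False by blast
qed

section \<open>The language of a transition system\<close>

text \<open>
  A language does not remember how the earlier words of a factorization were chosen. Here the
  position of a cut in a code is the state that has been reached, and a word that is no prefix of a
  code cannot occur when the factorization of a code is cut at its levels.
\<close>

definition run_lang :: "(nat \<Rightarrow> nat \<Rightarrow> bool list set) \<Rightarrow> bool list set" where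
  "run_lang D = {blocks \<beta> n m | \<beta> n m. n < m \<and> prefix m \<beta> \<in> D n m} \<union> {u. uncoded u}"

text \<open>A segment contains at least its first block, which is longer than \<open>n + 2\<close>,
  so \<alpha> shows the marker that reveals the level \<open>n\<close>.\<close>

lemma run_langE:
  assumes "prefix k \<alpha> \<in> run_lang D" "\<not> uncoded (prefix k \<alpha>)"
  obtains \<beta> n m where "n < m" "prefix m \<beta> \<in> D n m" "k = length (blocks \<beta> n m)"
    "prefix k \<alpha> = blocks \<beta> n m" "\<And>i. i \<le> Suc (Suc n) \<Longrightarrow> \<alpha> i = code n \<beta> i"
proof -
  from assms obtain \<beta> n m where *: "n < m" "prefix m \<beta> \<in> D n m" "prefix k \<alpha> = blocks \<beta> n m"
    unfolding run_lang_def by blast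
  have k: "k = length (blocks \<beta> n m)"
    using arg_cong[OF *(3), of length] by simp
  have "length (blocks \<beta> n (Suc n)) \<le> k"
    using *(1) unfolding k by (subst blocks_append[of n "Suc n" m]) auto
  then have "Suc (Suc n) < k"
    by (simp add: blocks_def)
  moreover have "prefix k \<alpha> = prefix k (code n \<beta>)"
    using *(1,3) by (simp add: k prefix_code)
  ultimately have "\<alpha> i = code n \<beta> i" if "i \<le> Suc (Suc n)" for i
    using that unfolding prefix_eq_iff by simp
  with * k that show thesis by blast
qed

text \<open>A first factor would be a segment and hence contain a second
  \<open>True\<close>.\<close>

lemma unary_limit_notin_omega_power: "unary_limit \<notin> omega_power (run_lang D)"
proof
  assume "unary_limit \<in> omega_power (run_lang D)"
  then obtain k where "prefix k unary_limit \<in> run_lang D"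
    using omega_powerD by blast
  then obtain n \<beta> where "unary_limit (Suc (Suc n)) = code n \<beta> (Suc (Suc n))"
    using not_uncoded_unary_limit by (rule run_langE) blast
  then show False
    using code_head(3)[of n \<beta>] by (simp add: unary_limit_def)
qed

text \<open>A transition system whose states are the levels; a label depends on \<open>m\<close>
  letters only, which the segment up to level \<open>m\<close> displays.\<close>

abbreviation run_steps :: "(nat \<Rightarrow> nat \<Rightarrow> bool list set) \<Rightarrow> nat \<Rightarrow> nat \<Rightarrow> (nat \<Rightarrow> bool) set" where
  "run_steps D \<equiv> \<lambda>n m. {\<beta>. n < m \<and> prefix m \<beta> \<in> D n m}"

text \<open>A prefix of a code can only be in the language as a segment, and its beginning reveals
  the level. So the cuts of a factorization trace a run, and a run provides the cuts.\<close>

lemma code_in_omega_power_iff: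
  "code n \<beta> \<in> omega_power (run_lang D) \<longleftrightarrow> accepts (run_steps D) \<beta> n"
proof
  assume "code n \<beta> \<in> omega_power (run_lang D)"
  then show "accepts (run_steps D) \<beta> n"
  proof (coinduction arbitrary: n)
    case accepts
    from omega_powerD[OF this] obtain k
      where k: "prefix k (code n \<beta>) \<in> run_lang D" "suffix k (code n \<beta>) \<in> omega_power (run_lang D)"
      by blast
    from k(1) not_uncoded_code obtain \<gamma> l m
      where lm: "l < m" "prefix m \<gamma> \<in> D l m" "k = length (blocks \<gamma> l m)"
        "prefix k (code n \<beta>) = blocks \<gamma> l m" "\<And>i. i \<le> Suc (Suc l) \<Longrightarrow> code n \<beta> i = code l \<gamma> i"
      by (rule run_langE) blast
    have "n = l"
    proof (rule ccontr)
      assume "n \<noteq> l"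
      then consider "l < n" | "n < l" by linarith
      then show False
        using lm(5)[of "Suc (Suc l)"] lm(5)[of "Suc (Suc n)"] code_head(3)[of l \<gamma>] code_head(3)[of n \<beta>]
          code_head(2)[of "Suc (Suc l)" n \<beta>] code_head(2)[of "Suc (Suc n)" l \<gamma>] by cases simp_all
    qed
    have len: "k = length (blocks \<beta> n m)"
      using lm(3) length_blocks_cong \<open>n = l\<close> by metis
    then have "blocks \<beta> n m = blocks \<gamma> n m"
      using lm(1,4) \<open>n = l\<close> prefix_code[of n m \<beta>] by simp
    \<comment> \<open>The segment comes with a word \<gamma> of its own; its last block forces
      agreement with \<beta> up to \<open>m\<close>.\<close>
    then have "prefix m \<beta> = prefix m \<gamma>"
      using lm(1) \<open>n = l\<close> by (intro blocks_inj) simp_all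
    then have "\<beta> \<in> run_steps D n m"
      using lm(1,2) \<open>n = l\<close> by simp
    moreover have "code m \<beta> \<in> omega_power (run_lang D)"
      using k(2) suffix_code[of n m \<beta>] lm(1) \<open>n = l\<close> len by simp
    ultimately show ?case by blast
  qed
next
  assume "accepts (run_steps D) \<beta> n"
  then show "code n \<beta> \<in> omega_power (run_lang D)"
  proof (intro omega_power_coinduct[of _ "{code n \<beta> | n. accepts (run_steps D) \<beta> n}"])
    fix \<alpha> assume "\<alpha> \<in> {code n \<beta> | n. accepts (run_steps D) \<beta> n}"
    then obtain n where n: "\<alpha> = code n \<beta>" "accepts (run_steps D) \<beta> n" by blast
    from n(2) obtain m where m: "n < m" "prefix m \<beta> \<in> D n m" "accepts (run_steps D) \<beta> m"
      by (cases rule: accepts.cases) auto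
    let ?k = "length (blocks \<beta> n m)"
    have "0 < ?k"
      by (rule less_le_trans[OF _ length_blocks_ge]) (use m(1) in simp)
    moreover have "prefix ?k \<alpha> \<in> run_lang D"
      using m(1,2) unfolding n(1) run_lang_def by (simp only: prefix_code less_imp_le) blast
    moreover have "suffix ?k \<alpha> = code m \<beta>"
      using m(1) unfolding n(1) by (simp only: suffix_code less_imp_le)
    ultimately show "\<exists>k>0. prefix k \<alpha> \<in> run_lang D \<and> suffix k \<alpha> \<in> {code n \<beta> | n. accepts (run_steps D) \<beta> n}"
      using m(3) by (intro exI[of _ ?k]) auto
  qed blast
qed

lemma omega_power_run_lang:
  "omega_power (run_lang D) =
    (\<Union>k. {\<alpha>. uncoded (prefix k \<alpha>)}) \<union> (\<Union>n. code n ` {\<beta>. accepts (run_steps D) \<beta> n})"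
  "- omega_power (run_lang D) =
    {unary_limit} \<union> (\<Union>n. code n ` {\<beta>. \<not> accepts (run_steps D) \<beta> n})"
proof -
  have absorb: "\<alpha> \<in> omega_power (run_lang D)" if "uncoded (prefix k \<alpha>)" for \<alpha> k
    by (rule omega_power_absorbing[of _ k])
      (auto simp: run_lang_def uncoded_prefix_mono[OF that] intro: uncoded_False uncoded_True_True)
  show "omega_power (run_lang D) =
    (\<Union>k. {\<alpha>. uncoded (prefix k \<alpha>)}) \<union> (\<Union>n. code n ` {\<beta>. accepts (run_steps D) \<beta> n})"
    (is "_ = ?R")
  proof (intro equalityI subsetI)
    fix \<alpha> assume \<alpha>: "\<alpha> \<in> omega_power (run_lang D)"
    from uncoded_unary_limit_or_code[of \<alpha>] show "\<alpha> \<in> ?R"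
      using \<alpha> unary_limit_notin_omega_power[of D] code_in_omega_power_iff[of _ _ D] by blast
  next
    fix \<alpha> assume "\<alpha> \<in> ?R"
    then show "\<alpha> \<in> omega_power (run_lang D)"
      using absorb code_in_omega_power_iff[of _ _ D] by blast
  qed
  show "- omega_power (run_lang D) =
    {unary_limit} \<union> (\<Union>n. code n ` {\<beta>. \<not> accepts (run_steps D) \<beta> n})"
    (is "_ = ?R")
  proof (intro equalityI subsetI)
    fix \<alpha> assume \<alpha>: "\<alpha> \<in> - omega_power (run_lang D)"
    from uncoded_unary_limit_or_code[of \<alpha>] show "\<alpha> \<in> ?R"
      using \<alpha> absorb code_in_omega_power_iff[of _ _ D] by blast
  next
    fix \<alpha> assume "\<alpha> \<in> ?R"
    then show "\<alpha> \<in> - omega_power (run_lang D)"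
      using unary_limit_notin_omega_power[of D] code_in_omega_power_iff[of _ _ D] by blast
  qed
qed

section \<open>Borel class of the \<open>\<omega>\<close>-power\<close>

lemma closedin_uncoded: "closedin (omega_words UNIV) {\<alpha>. uncoded (prefix k \<alpha>)}"
proof -
  have "openin (omega_words UNIV) (- {\<alpha>. uncoded (prefix k \<alpha>)})"
    by (rule openin_omega_words_finite_dep[of _ _ k]) (simp_all add: uncoded_prefix_iff)
  then show ?thesis
    by (simp add: closedin_def Compl_eq_Diff_UNIV)
qed

text \<open>The image of \<open>M n\<close> under \<open>code n\<close> is the preimage of
  \<open>M n\<close> under \<open>decode n\<close>, cut down to the closed range of
  \<open>code n\<close>.\<close>

lemma Sigma0_UN_code:
  assumes \<xi>: "card (Field \<xi>) \<noteq> 1" and M: "\<And>n. Sigma0 (omega_words UNIV) \<xi> (M n)"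
    and C: "Sigma0 (omega_words UNIV) \<xi> C"
  shows "Sigma0 (omega_words UNIV) \<xi> (C \<union> (\<Union>n. code n ` M n))"
proof -
  have code: "Sigma0 (omega_words UNIV) \<xi> (code n ` M n)" for n
  proof -
    have "Sigma0 (omega_words UNIV) \<xi>
        ({\<alpha> \<in> topspace (omega_words UNIV). decode n \<alpha> \<in> M n} \<inter> range (code n))"
      using Sigma0_preimage(1)[OF continuous_map_decode M] closedin_range_code \<xi>
      by (rule Sigma0_Int_closedin)
    also have "{\<alpha> \<in> topspace (omega_words UNIV). decode n \<alpha> \<in> M n} \<inter> range (code n) = code n ` M n"
      by auto
    finally show ?thesis .
  qed
  have "Sigma0 (omega_words UNIV) \<xi> (case i of 0 \<Rightarrow> C | Suc n \<Rightarrow> code n ` M n)" for i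
    using C code by (cases i) simp_all
  then have "Sigma0 (omega_words UNIV) \<xi> (\<Union>i. case i of 0 \<Rightarrow> C | Suc n \<Rightarrow> code n ` M n)"
    by (rule Sigma0_UN[OF \<xi>])
  also have "(\<Union>i. case i of 0 \<Rightarrow> C | Suc n \<Rightarrow> code n ` M n) = C \<union> (\<Union>n. code n ` M n)"
    by (subst UNIV_nat_eq) simp
  finally show ?thesis .
qed

theorem omega_power_Sigma0:
  assumes \<xi>: "Well_order \<xi>" "Field \<xi> \<noteq> {}" "card (Field \<xi>) \<noteq> 1"
    and D: "\<And>n. Sigma0 (omega_words UNIV) \<xi> {\<beta>. accepts (run_steps D) \<beta> n}"
  shows "Sigma0 (omega_words UNIV) \<xi> (omega_power (run_lang D))"
  unfolding omega_power_run_lang(1)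
  by (intro Sigma0_UN_code Sigma0_UN D \<xi>(3) closedin_imp_Sigma0[OF \<xi> closedin_uncoded])

text \<open>The complement is used, as it is a countable union of sets in the dual class: the
  rejected codes of each level and one point.\<close>

theorem omega_power_Pi0:
  assumes \<xi>: "Well_order \<xi>" "Field \<xi> \<noteq> {}" "card (Field \<xi>) \<noteq> 1"
    and D: "\<And>n. Pi0 (omega_words UNIV) \<xi> {\<beta>. accepts (run_steps D) \<beta> n}"
  shows "Pi0 (omega_words UNIV) \<xi> (omega_power (run_lang D))"
proof -
  have "Sigma0 (omega_words UNIV) \<xi> (topspace (omega_words UNIV) - {\<beta>. accepts (run_steps D) \<beta> n})" for n
    using D by (rule Sigma0_compl)
  then have neg: "Sigma0 (omega_words UNIV) \<xi> {\<beta>. \<not> accepts (run_steps D) \<beta> n}" for n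
    by (simp add: Collect_neg_eq Compl_eq_Diff_UNIV)
  have lim: "closedin (omega_words UNIV) {unary_limit}"
    using Hausdorff_space_omega_words by (rule closedin_Hausdorff_singleton) simp
  have "Sigma0 (omega_words UNIV) \<xi> (- omega_power (run_lang D))"
    unfolding omega_power_run_lang(2)
    by (rule Sigma0_UN_code[OF \<xi>(3) neg closedin_imp_Sigma0[OF \<xi> lim]])
  then show ?thesis
    using Sigma0_compl_iff[of "omega_power (run_lang D)" "omega_words UNIV" \<xi>]
    by (simp add: Compl_eq_Diff_UNIV)
qed

text \<open>
  Level \<open>n\<close> stands for the state \<open>fst (prod_decode n)\<close>. Every state occurs at arbitrarily late levels,
  where the prefix of length \<open>n\<close> is long enough to witness a given open condition.
\<close>

lemma represented_run_steps:
  assumes "represented (omega_words UNIV) \<Gamma> B"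
  shows "\<exists>D n. (\<forall>m. \<Gamma> {\<beta>. accepts (run_steps D) \<beta> m}) \<and> B = {\<beta>. accepts (run_steps D) \<beta> n}"
proof -
  from assms obtain U :: "nat \<Rightarrow> nat \<Rightarrow> (nat \<Rightarrow> bool) set" and p
    where U: "\<And>q r. openin (omega_words UNIV) (U q r)" "\<And>q. \<Gamma> {\<beta>. accepts U \<beta> q}"
      "B = {\<beta>. accepts U \<beta> p}"
    unfolding represented_def by blast
  define s where "s n = fst (prod_decode n)" for n
  \<comment> \<open>A word of length \<open>m\<close> is in \<open>D n m\<close> iff its cylinder
    lies in the label between the states of the two levels.\<close>
  define D where "D n m = {w. \<forall>\<beta>. prefix m \<beta> = w \<longrightarrow> \<beta> \<in> U (s n) (s m)}" for n m
  have acc: "accepts (run_steps D) \<beta> n \<longleftrightarrow> accepts U \<beta> (s n)" for \<beta> n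
  proof
    assume "accepts (run_steps D) \<beta> n"
    then show "accepts U \<beta> (s n)"
    proof (coinduction arbitrary: n)
      case accepts
      then obtain m where "\<beta> \<in> run_steps D n m" "accepts (run_steps D) \<beta> m"
        by (auto elim: accepts.cases)
      moreover from this(1) have "\<beta> \<in> U (s n) (s m)"
        by (simp add: D_def)
      ultimately show ?case by blast
    qed
  next
    assume "accepts U \<beta> (s n)"
    then show "accepts (run_steps D) \<beta> n"
    proof (coinduction arbitrary: n)
      case accepts
      then obtain q where q: "\<beta> \<in> U (s n) q" "accepts U \<beta> q"
        by (auto elim: accepts.cases)
      obtain k where k: "\<And>\<gamma>. \<forall>i<k. \<gamma> i = \<beta> i \<Longrightarrow> \<gamma> \<in> U (s n) q"
        using bspec[OF U(1)[of "s n" q, unfolded openin_omega_words_iff] q(1)] by blast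
      \<comment> \<open>A level of state \<open>q\<close> that is above \<open>n\<close> and late
        enough for the prefix to witness the open label.\<close>
      define m where "m = prod_encode (q, max k (Suc n))"
      have "max k (Suc n) \<le> m"
        unfolding m_def by (rule le_prod_encode_2)
      have "s m = q"
        by (simp add: s_def m_def)
      have "prefix m \<beta> \<in> D n m"
        using k \<open>max k (Suc n) \<le> m\<close> by (simp add: D_def prefix_eq_iff \<open>s m = q\<close>)
      then show ?case
        using q(2) \<open>max k (Suc n) \<le> m\<close> \<open>s m = q\<close>
        by (intro exI[of _ n] exI[of _ m]) simp
    qed
  qed
  have "s (prod_encode (p, 0)) = p"
    by (simp add: s_def)
  then show ?thesis
    using U(2,3) by (intro exI[of _ D] exI[of _ "prod_encode (p, 0)"]) (simp only: acc simp_thms)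
qed

section \<open>Complete sets\<close>

text \<open>Continuous (Wadge) reducibility.\<close>

definition reduces :: "'a topology \<Rightarrow> 'a set \<Rightarrow> (nat \<Rightarrow> bool) set \<Rightarrow> bool" where
  "reduces X E F \<longleftrightarrow>
    (\<exists>g. continuous_map X (omega_words UNIV) g \<and> E = {x \<in> topspace X. g x \<in> F})"

lemma reduces_compl:
  assumes "reduces X (topspace X - E) F" "E \<subseteq> topspace X"
  shows "reduces X E (- F)"
proof -
  from assms(1) obtain g where g: "continuous_map X (omega_words UNIV) g"
    "topspace X - E = {x \<in> topspace X. g x \<in> F}"
    unfolding reduces_def by blast
  then have "E = {x \<in> topspace X. g x \<in> - F}"
    using assms(2) by auto
  with g(1) show ?thesis
    unfolding reduces_def by blast
qed

lemma reduces_compose: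
  assumes "reduces X E F" "continuous_map (omega_words UNIV) (omega_words UNIV) h"
    and "\<And>\<beta>. \<beta> \<in> F \<longleftrightarrow> h \<beta> \<in> G"
  shows "reduces X E G"
proof -
  from assms(1) obtain g where g: "continuous_map X (omega_words UNIV) g"
    "E = {x \<in> topspace X. g x \<in> F}"
    unfolding reduces_def by blast
  show ?thesis
    unfolding reduces_def
    using continuous_map_compose[OF g(1) assms(2)] g(2) assms(3)
    by (intro exI[of _ "h \<circ> g"]) simp
qed

text \<open>Letter \<open>i\<close> of the image reports whether the first \<open>i\<close> letters
  already force membership in \<open>E\<close>.\<close>

lemma reduces_open:
  assumes "openin (omega_words Y) E"
  shows "reduces (omega_words Y) E {\<beta>. \<exists>i. \<beta> i}"
proof -
  define g where "g \<alpha> i \<longleftrightarrow> (\<forall>\<beta>. (\<forall>j. \<beta> j \<in> Y) \<and> (\<forall>j<i. \<beta> j = \<alpha> j) \<longrightarrow> \<beta> \<in> E)" for \<alpha> and i :: nat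
  have "continuous_map (omega_words Y) (omega_words UNIV) g"
  proof (rule continuous_map_omega_words_finite_dep)
    fix i
    show "\<exists>n. \<forall>\<alpha> \<beta>. (\<forall>j. \<alpha> j \<in> Y) \<longrightarrow> (\<forall>j. \<beta> j \<in> Y) \<longrightarrow> (\<forall>j<n. \<beta> j = \<alpha> j) \<longrightarrow> g \<beta> i = g \<alpha> i"
      by (intro exI[of _ i]) (simp add: g_def)
  qed
  moreover have "E = {\<alpha> \<in> topspace (omega_words Y). g \<alpha> \<in> {\<beta>. \<exists>i. \<beta> i}}"
  proof (intro equalityI subsetI)
    fix \<alpha> assume "\<alpha> \<in> E"
    from bspec[OF assms[unfolded openin_omega_words_iff] this]
    have "\<forall>i. \<alpha> i \<in> Y" "\<exists>i. g \<alpha> i"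
      unfolding g_def by blast+
    then show "\<alpha> \<in> {\<alpha> \<in> topspace (omega_words Y). g \<alpha> \<in> {\<beta>. \<exists>i. \<beta> i}}"
      by simp
  next
    fix \<alpha> assume "\<alpha> \<in> {\<alpha> \<in> topspace (omega_words Y). g \<alpha> \<in> {\<beta>. \<exists>i. \<beta> i}}"
    then obtain i where "\<forall>j. \<alpha> j \<in> Y" "g \<alpha> i" by auto
    then show "\<alpha> \<in> E"
      unfolding g_def by blast
  qed
  ultimately show ?thesis
    unfolding reduces_def by blast
qed

lemma openin_some_True: "openin (omega_words UNIV) {\<beta> :: nat \<Rightarrow> bool. \<exists>i. \<beta> i}"
  unfolding openin_omega_words_iff
proof
  fix \<alpha> :: "nat \<Rightarrow> bool" assume "\<alpha> \<in> {\<beta>. \<exists>i. \<beta> i}"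
  then obtain i where "\<alpha> i" by blast
  then show "(\<forall>i. \<alpha> i \<in> UNIV) \<and>
      (\<exists>n. \<forall>\<beta>. (\<forall>i. \<beta> i \<in> UNIV) \<and> (\<forall>i<n. \<beta> i = \<alpha> i) \<longrightarrow> \<beta> \<in> {\<beta>. \<exists>i. \<beta> i})"
    by (intro conjI exI[of _ "Suc i"]) auto
qed

section \<open>Hard sets at all levels\<close>

definition Sigma0_hard :: "nat rel \<Rightarrow> (nat \<Rightarrow> bool) set \<Rightarrow> bool" where
  "Sigma0_hard \<xi> F \<longleftrightarrow>
    (\<forall>(Y :: nat set) E. Sigma0 (omega_words Y) \<xi> E \<longrightarrow> reduces (omega_words Y) E F)"

definition Pi0_hard :: "nat rel \<Rightarrow> (nat \<Rightarrow> bool) set \<Rightarrow> bool" where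
  "Pi0_hard \<xi> F \<longleftrightarrow>
    (\<forall>(Y :: nat set) E. Pi0 (omega_words Y) \<xi> E \<longrightarrow> reduces (omega_words Y) E F)"

lemma Pi0_hard_compl: "Sigma0_hard \<xi> F \<Longrightarrow> Pi0_hard \<xi> (- F)"
  unfolding Sigma0_hard_def Pi0_hard_def
  by (blast intro: reduces_compl Sigma0_compl(2) dest: Sigma0_subset_topspace(2))

lemma Pi0_compl: "Sigma0 (omega_words UNIV) \<xi> S \<Longrightarrow> Pi0 (omega_words UNIV) \<xi> (- S)"
  using Sigma0_compl(1)[of "omega_words UNIV" \<xi> S] by (simp add: Compl_eq_Diff_UNIV)

lemma Sigma0_hard_exists_one:
  assumes "Well_order \<xi>" "card (Field \<xi>) = 1"
  shows "Sigma0_hard \<xi> {\<beta>. \<exists>i. \<beta> i}" "Sigma0 (omega_words UNIV) \<xi> {\<beta> :: nat \<Rightarrow> bool. \<exists>i. \<beta> i}"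
  unfolding Sigma0_hard_def Sigma0_one_iff[OF assms] using openin_some_True reduces_open by blast+

lemma ordLess_initial_segment:
  fixes \<xi> :: "nat rel"
  assumes "Well_order \<xi>" "a \<in> Field \<xi>"
  shows "(Restr \<xi> (underS \<xi> a), \<xi>) \<in> ordLess"
proof -
  have "Well_order (Restr \<xi> (underS \<xi> a))"
    using assms(1) by (rule Well_order_Restr)
  then have "(Restr \<xi> (underS \<xi> a), Restr \<xi> (underS \<xi> a)) \<in> ordIso"
    by (rule ordIso_reflexive)
  then show ?thesis
    using assms \<open>Well_order (Restr \<xi> (underS \<xi> a))\<close> by (subst ordLess_iff_ordIso_Restr) blast+
qed

text \<open>
  Non-triviality of the sets is carried along, as a word outside \<open>F (a i)\<close> serves as a default
  value for the unused sections.
\<close>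

lemma Sigma0_hard_Union:
  fixes \<gamma> :: "nat \<Rightarrow> nat rel" and a :: "nat \<Rightarrow> nat"
  assumes F: "\<And>i. Pi0 (omega_words UNIV) (\<gamma> (a i)) (F (a i))" "\<And>i. Pi0_hard (\<gamma> (a i)) (F (a i))"
    "\<And>i. F (a i) \<noteq> {}" "\<And>i. F (a i) \<noteq> UNIV"
    and less: "\<And>i. (\<gamma> (a i), \<xi>) \<in> ordLess"
    and cof: "\<And>\<delta> X S. (\<delta>, \<xi>) \<in> ordLess \<Longrightarrow> Pi0 X \<delta> (S :: (nat \<Rightarrow> nat) set) \<Longrightarrow>
      \<exists>b. (\<forall>k. a (prod_encode (b, k)) = b) \<and> Pi0 X (\<gamma> b) S"
    and \<xi>: "card (Field \<xi>) \<noteq> 1"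
  defines "B \<equiv> {\<beta>. \<exists>i. (\<lambda>j. \<beta> (prod_encode (i, j))) \<in> F (a i)}"
  shows "Sigma0 (omega_words UNIV) \<xi> B" "Sigma0_hard \<xi> B" "B \<noteq> {}" "B \<noteq> UNIV"
proof -
  let ?sec = "\<lambda>i \<beta> j. \<beta> (prod_encode (i, j))"
  have "Sigma0 (omega_words UNIV) \<xi> (\<Union>i. {\<beta> \<in> topspace (omega_words UNIV). ?sec i \<beta> \<in> F (a i)})"
    by (rule Sigma0_Union[of "\<lambda>i. \<gamma> (a i)", OF less])
      (rule Sigma0_preimage(2)[OF continuous_map_omega_words_reindex F(1)])
  also have "(\<Union>i. {\<beta> \<in> topspace (omega_words UNIV). ?sec i \<beta> \<in> F (a i)}) = B"
    by (auto simp: B_def)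
  finally show "Sigma0 (omega_words UNIV) \<xi> B" .
  have "\<exists>z. z \<notin> F (a i)" for i
    using F(4)[of i] by blast
  then obtain z where z: "\<And>i. z i \<notin> F (a i)"
    by metis
  obtain c where c: "c \<in> F (a 0)"
    using F(3) by blast
  then have "(\<lambda>l. c (snd (prod_decode l))) \<in> B"
    unfolding B_def by (intro CollectI exI[of _ 0]) simp
  then show "B \<noteq> {}" by blast
  have "(\<lambda>l. z (fst (prod_decode l)) (snd (prod_decode l))) \<notin> B"
    using z by (simp add: B_def)
  then show "B \<noteq> UNIV" by blast
  show "Sigma0_hard \<xi> B"
    unfolding Sigma0_hard_def
  proof (intro allI impI)
    fix Y :: "nat set" and E assume "Sigma0 (omega_words Y) \<xi> E"
    then obtain \<delta> T where T: "\<And>k::nat. (\<delta> k, \<xi>) \<in> ordLess" "\<And>k. Pi0 (omega_words Y) (\<delta> k) (T k)"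
      "E = (\<Union>k. T k)"
      using Sigma0_Union_cases[OF _ \<xi>] by metis
    \<comment> \<open>The level \<open>b n\<close> suits \<open>T n\<close> and is repeated at the
      index of every pair \<open>(b n, k)\<close>.\<close>
    have "\<exists>b. (\<forall>k. a (prod_encode (b, k)) = b) \<and> Pi0 (omega_words Y) (\<gamma> b) (T n)" for n
      using cof T(1,2) by blast
    then obtain b where b: "\<And>n k. a (prod_encode (b n, k)) = b n"
      "\<And>n. Pi0 (omega_words Y) (\<gamma> (b n)) (T n)"
      by metis
    have "reduces (omega_words Y) (T n) (F (b n))" for n
      using F(2)[of "prod_encode (b n, 0)"] b unfolding Pi0_hard_def by simp
    then have "\<forall>n. \<exists>g. continuous_map (omega_words Y) (omega_words UNIV) g \<and>
        T n = {x \<in> topspace (omega_words Y). g x \<in> F (b n)}"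
      unfolding reduces_def by blast
    from choice[OF this] obtain g where g: "\<And>n. continuous_map (omega_words Y) (omega_words UNIV) (g n)"
      "\<And>n. T n = {x \<in> topspace (omega_words Y). g n x \<in> F (b n)}"
      by blast
    \<comment> \<open>Section \<open>prod_encode (b n, n)\<close> carries the reduction of
      \<open>T n\<close>; the second component keeps the sections of different \<open>n\<close>
      apart. All others hold a rejected word.\<close>
    define h where "h x l = (case prod_decode l of (i, j) \<Rightarrow>
      let n = snd (prod_decode i) in if i = prod_encode (b n, n) then g n x j else z i j)" for x l
    have sec: "?sec i (h x) =
        (let n = snd (prod_decode i) in if i = prod_encode (b n, n) then g n x else z i)" for i x
      by (simp add: h_def Let_def fun_eq_iff)
    have "continuous_map (omega_words Y) (omega_words UNIV) h"
      unfolding continuous_map_omega_words_iff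
    proof
      fix l
      obtain i j where l: "prod_decode l = (i, j)" by fastforce
      define n where "n = snd (prod_decode i)"
      have "(\<lambda>x. h x l) = (if i = prod_encode (b n, n) then (\<lambda>x. g n x j) else (\<lambda>x. z i j))"
        by (simp add: h_def l Let_def n_def fun_eq_iff)
      then show "continuous_map (omega_words Y) (discrete_topology UNIV) (\<lambda>x. h x l)"
        using g(1)[of n, unfolded continuous_map_omega_words_iff] by simp
    qed
    moreover have "h x \<in> B \<longleftrightarrow> x \<in> E" if x: "x \<in> topspace (omega_words Y)" for x
    proof
      assume "h x \<in> B"
      then obtain i where i: "?sec i (h x) \<in> F (a i)"
        unfolding B_def by blast
      define n where "n = snd (prod_decode i)"
      have i_eq: "i = prod_encode (b n, n)"
      proof (rule ccontr)
        assume "i \<noteq> prod_encode (b n, n)"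
        then have "?sec i (h x) = z i"
          unfolding sec by (simp add: Let_def n_def)
        with i z show False by simp
      qed
      then have "?sec i (h x) = g n x"
        unfolding sec by (simp add: Let_def n_def)
      with i have "g n x \<in> F (b n)"
        by (subst (asm) (2) i_eq) (simp add: b(1))
      then show "x \<in> E"
        using x g(2)[of n] T(3) by blast
    next
      assume "x \<in> E"
      then obtain n where "g n x \<in> F (b n)"
        using g(2) T(3) by blast
      then have "?sec (prod_encode (b n, n)) (h x) \<in> F (a (prod_encode (b n, n)))"
        unfolding sec by (simp add: b(1))
      then show "h x \<in> B"
        unfolding B_def by blast
    qed
    moreover have "E \<subseteq> topspace (omega_words Y)"
      using T(2,3) Sigma0_subset_topspace(2) by blast
    ultimately show "reduces (omega_words Y) E B"
      unfolding reduces_def by (intro exI[of _ h]) blast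
  qed
qed

text \<open>Well-founded induction: complements of hard sets for the initial segments of \<xi> serve
  as sections, and these segments represent all smaller order types.\<close>

lemma Sigma0_hard_exists:
  assumes "Well_order \<xi>" "Field \<xi> \<noteq> {}"
  shows "\<exists>B. Sigma0 (omega_words UNIV) \<xi> B \<and> Sigma0_hard \<xi> B \<and> B \<noteq> {} \<and> B \<noteq> UNIV"
  using wf_ordLess assms
proof (induction \<xi> rule: wf_induct_rule)
  case (less \<xi>)
  show ?case
  proof (cases "card (Field \<xi>) = 1")
    case True
    then have "Sigma0 (omega_words UNIV) \<xi> {\<beta> :: nat \<Rightarrow> bool. \<exists>i. \<beta> i}" "Sigma0_hard \<xi> {\<beta>. \<exists>i. \<beta> i}"
      using Sigma0_hard_exists_one less.prems(1) by blast+
    moreover have "{\<beta> :: nat \<Rightarrow> bool. \<exists>i. \<beta> i} \<noteq> {}" "{\<beta> :: nat \<Rightarrow> bool. \<exists>i. \<beta> i} \<noteq> UNIV"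
      by (auto simp: set_eq_iff)
    ultimately show ?thesis by blast
  next
    case False
    \<comment> \<open>Without the least element, whose initial segment is null and has no
      sets.\<close>
    define I where "I = {a \<in> Field \<xi>. underS \<xi> a \<noteq> {}}"
    define \<gamma> where "\<gamma> a = Restr \<xi> (underS \<xi> a)" for a
    have \<gamma>_less: "(\<gamma> a, \<xi>) \<in> ordLess" if "a \<in> I" for a
      unfolding \<gamma>_def using that less.prems(1) by (intro ordLess_initial_segment) (simp_all add: I_def)
    have Field_\<gamma>: "Field (\<gamma> a) = underS \<xi> a" for a
      unfolding \<gamma>_def
      by (rule Field_Restr_ofilter[OF less.prems(1)])
        (use less.prems(1) in \<open>simp add: wo_rel.underS_ofilter wo_rel_def\<close>)
    have "\<exists>F. Pi0 (omega_words UNIV) (\<gamma> a) F \<and> Pi0_hard (\<gamma> a) F \<and> F \<noteq> {} \<and> F \<noteq> UNIV" if "a \<in> I" for a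
    proof -
      have "Well_order (\<gamma> a)" "Field (\<gamma> a) \<noteq> {}"
        using ordLess_Well_order[OF \<gamma>_less[OF that]] that by (simp_all add: Field_\<gamma> I_def)
      with less.IH[OF \<gamma>_less[OF that]] obtain B where
        "Sigma0 (omega_words UNIV) (\<gamma> a) B" "Sigma0_hard (\<gamma> a) B" "B \<noteq> {}" "B \<noteq> UNIV"
        by blast
      then show ?thesis
        by (intro exI[of _ "- B"] conjI Pi0_compl Pi0_hard_compl) auto
    qed
    then obtain F where F: "\<And>a. a \<in> I \<Longrightarrow> Pi0 (omega_words UNIV) (\<gamma> a) (F a)"
      "\<And>a. a \<in> I \<Longrightarrow> Pi0_hard (\<gamma> a) (F a)" "\<And>a. a \<in> I \<Longrightarrow> F a \<noteq> {}" "\<And>a. a \<in> I \<Longrightarrow> F a \<noteq> UNIV"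
      by metis
    have seg: "\<exists>b\<in>I. Pi0 X (\<gamma> b) S" if \<delta>: "(\<delta>, \<xi>) \<in> ordLess" "Pi0 X \<delta> S" for \<delta> :: "nat rel" and X and S :: "'b set"
    proof -
      obtain b where b: "b \<in> Field \<xi>" "(\<delta>, \<gamma> b) \<in> ordIso"
        using \<delta>(1) ordLess_iff_ordIso_Restr[OF less.prems(1), of \<delta>] ordLess_Well_order[OF \<delta>(1)]
        by (auto simp: \<gamma>_def)
      have "Pi0 X (\<gamma> b) S"
        using \<delta>(2) b(2) by (rule Pi0_ordIso)
      moreover from Sigma0_level(2)[OF this] have "b \<in> I"
        using b(1) by (simp add: I_def Field_\<gamma>)
      ultimately show ?thesis by blast
    qed
    \<comment> \<open>The empty set only serves to show that \<open>I\<close> is non-empty.\<close>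
    have "Pi0 (omega_words (UNIV :: bool set)) ord_one {}"
      by (intro Pi0_closed Well_order_ord_one) simp_all
    then obtain a0 where "a0 \<in> I"
      using seg ord_one_ordLess[OF less.prems False] by blast
    \<comment> \<open>Every element of \<open>I\<close> is enumerated infinitely often, and
      \<open>a0\<close> fills the gaps.\<close>
    define a where "a i = (if fst (prod_decode i) \<in> I then fst (prod_decode i) else a0)" for i
    have aI: "a i \<in> I" for i
      using \<open>a0 \<in> I\<close> by (simp add: a_def)
    have cof: "\<exists>b. (\<forall>k. a (prod_encode (b, k)) = b) \<and> Pi0 X (\<gamma> b) S"
      if "(\<delta>, \<xi>) \<in> ordLess" "Pi0 X \<delta> S" for \<delta> :: "nat rel" and X and S :: "(nat \<Rightarrow> nat) set"
      using seg[OF that] by (auto simp: a_def)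
    note hard = Sigma0_hard_Union[of \<gamma> a F \<xi>, OF F(1)[OF aI] F(2)[OF aI] F(3)[OF aI] F(4)[OF aI]
        \<gamma>_less[OF aI] _ False]
    show ?thesis
      by (intro exI conjI; rule hard, erule (1) cof)
  qed
qed

section \<open>Complete \<omega>-powers\<close>

lemma Sigma0_completeI:
  assumes "Sigma0 (omega_words UNIV) \<xi> F" "Sigma0_hard \<xi> F"
  shows "Sigma0_complete \<xi> F"
  unfolding Sigma0_complete_def
proof (intro allI impI iffI)
  fix Y :: "nat set" and E
  show "\<exists>g. continuous_map (omega_words Y) (omega_words UNIV) g \<and> E = {\<alpha> \<in> topspace (omega_words Y). g \<alpha> \<in> F}"
    if "Sigma0 (omega_words Y) \<xi> E"
    using assms(2) that unfolding Sigma0_hard_def reduces_def by blast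
  show "Sigma0 (omega_words Y) \<xi> E"
    if "\<exists>g. continuous_map (omega_words Y) (omega_words UNIV) g \<and> E = {\<alpha> \<in> topspace (omega_words Y). g \<alpha> \<in> F}"
    using that Sigma0_preimage(1)[OF _ assms(1)] by blast
qed

lemma Pi0_completeI:
  assumes "Pi0 (omega_words UNIV) \<xi> F" "Pi0_hard \<xi> F"
  shows "Pi0_complete \<xi> F"
  unfolding Pi0_complete_def
proof (intro allI impI iffI)
  fix Y :: "nat set" and E
  show "\<exists>g. continuous_map (omega_words Y) (omega_words UNIV) g \<and> E = {\<alpha> \<in> topspace (omega_words Y). g \<alpha> \<in> F}"
    if "Pi0 (omega_words Y) \<xi> E"
    using assms(2) that unfolding Pi0_hard_def reduces_def by blast
  show "Pi0 (omega_words Y) \<xi> E"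
    if "\<exists>g. continuous_map (omega_words Y) (omega_words UNIV) g \<and> E = {\<alpha> \<in> topspace (omega_words Y). g \<alpha> \<in> F}"
    using that Sigma0_preimage(2)[OF _ assms(1)] by blast
qed

text \<open>The open case at level 1: a first factor deviates from the unary limit, and a word that
  deviates is absorbed because the unary limit starts with \<open>True\<close>,
  \<open>False\<close>.\<close>

lemma omega_power_nonprefix_unary_limit:
  "omega_power {u. prefix (length u) unary_limit \<noteq> u} = - {unary_limit}" (is "omega_power ?V = _")
proof (intro equalityI subsetI)
  fix \<alpha> assume "\<alpha> \<in> omega_power ?V"
  then obtain k where "prefix k \<alpha> \<in> ?V"
    using omega_powerD by blast
  then show "\<alpha> \<in> - {unary_limit}" by auto
next
  fix \<alpha> assume "\<alpha> \<in> - {unary_limit}"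
  then obtain i where "\<alpha> i \<noteq> unary_limit i"
    by (auto simp: fun_eq_iff)
  show "\<alpha> \<in> omega_power ?V"
  proof (rule omega_power_absorbing[of _ "Suc i"])
    show "u \<in> ?V" if "u \<noteq> []" "\<not> hd u" for u
      using that by (cases u) (auto simp: unary_limit_def subsequence_def upt_conv_Cons simp del: upt_Suc)
    show "u \<in> ?V" if "2 \<le> length u" "u ! 0" "u ! 1" for u
    proof
      show "prefix (length u) unary_limit \<noteq> u"
      proof
        assume "prefix (length u) unary_limit = u"
        then have "u ! 1 = unary_limit 1"
          using that(1) subsequence_nth[of 1 "length u" 0 unary_limit] by simp
        with that(3) show False by (simp add: unary_limit_def)
      qed
    qed
    show "prefix m \<alpha> \<in> ?V" if "Suc i \<le> m" for m
      using that \<open>\<alpha> i \<noteq> unary_limit i\<close> by (auto simp: prefix_eq_iff Suc_le_eq)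
  qed
qed

lemma omega_power_False: "omega_power {[False]} = {\<lambda>_. False}"
proof (intro equalityI subsetI)
  fix \<alpha> assume "\<alpha> \<in> omega_power {[False]}"
  from omega_power_letters[OF this] show "\<alpha> \<in> {\<lambda>_. False}"
    by (simp add: fun_eq_iff)
next
  fix \<alpha> :: "nat \<Rightarrow> bool" assume "\<alpha> \<in> {\<lambda>_. False}"
  then show "\<alpha> \<in> omega_power {[False]}"
  proof (rule omega_power_coinduct)
    fix \<beta> :: "nat \<Rightarrow> bool" assume "\<beta> \<in> {\<lambda>_. False}"
    then show "\<exists>k>0. prefix k \<beta> \<in> {[False]} \<and> suffix k \<beta> \<in> {\<lambda>_. False}"
      by (intro exI[of _ 1]) (auto simp: suffix_def)
  qed
qed

theorem theorem2:
  fixes \<xi> :: "nat rel"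
  assumes "Well_order \<xi>" and "Field \<xi> \<noteq> {}"
  shows "(\<exists>A :: bool list set. Sigma0_complete \<xi> (omega_power A)) \<and>
         (\<exists>A :: bool list set. Pi0_complete \<xi> (omega_power A))"
proof (cases "card (Field \<xi>) = 1")
  case True
  let ?B = "{\<beta> :: nat \<Rightarrow> bool. \<exists>i. \<beta> i}"
  note B = Sigma0_hard_exists_one[OF assms(1) True]
  have "Sigma0_hard \<xi> (- {unary_limit})"
    unfolding Sigma0_hard_def
  proof (intro allI impI)
    fix Y :: "nat set" and E assume "Sigma0 (omega_words Y) \<xi> E"
    then have "reduces (omega_words Y) E ?B"
      using B(1) unfolding Sigma0_hard_def by blast
    then show "reduces (omega_words Y) E (- {unary_limit})"
    proof (rule reduces_compose)
      \<comment> \<open>Prepending \<open>True\<close> sends exactly the word without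
        \<open>True\<close> to the unary limit.\<close>
      show "continuous_map (omega_words UNIV) (omega_words UNIV) (\<lambda>\<beta> i. i = 0 \<or> \<beta> (i - 1))"
        by (rule continuous_map_omega_words_finite_dep) (metis lessI)
      have "(\<lambda>i. i = 0 \<or> \<beta> (i - 1)) = unary_limit \<longleftrightarrow> (\<forall>i. \<not> \<beta> i)" for \<beta>
      proof
        assume eq: "(\<lambda>i. i = 0 \<or> \<beta> (i - 1)) = unary_limit"
        show "\<forall>i. \<not> \<beta> i"
          using fun_cong[OF eq, of "Suc _"] by (simp add: unary_limit_def)
      qed (simp add: unary_limit_def)
      then show "\<beta> \<in> ?B \<longleftrightarrow> (\<lambda>i. i = 0 \<or> \<beta> (i - 1)) \<in> - {unary_limit}" for \<beta>
        by simp
    qed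
  qed
  moreover have "openin (omega_words UNIV) (- {unary_limit})"
    using closedin_Hausdorff_singleton[OF Hausdorff_space_omega_words, of unary_limit UNIV]
    by (simp add: closedin_def Compl_eq_Diff_UNIV)
  ultimately have "Sigma0_complete \<xi> (- {unary_limit})"
    using assms(1) True by (intro Sigma0_completeI) (simp_all add: Sigma0_one_iff)
  moreover have "- ?B = {\<lambda>_. False}"
    by (auto simp: fun_eq_iff)
  then have "Pi0_complete \<xi> {\<lambda>_. False}"
    using Pi0_completeI[OF Pi0_compl[OF B(2)] Pi0_hard_compl[OF B(1)]] by simp
  ultimately show ?thesis
    using omega_power_nonprefix_unary_limit omega_power_False by metis
next
  case False
  \<comment> \<open>\<open>B\<close> and its complement are represented by separate systems, one for
    each class.\<close>
  obtain B where B: "Sigma0 (omega_words UNIV) \<xi> B" "Sigma0_hard \<xi> B"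
    using Sigma0_hard_exists[OF assms] by blast
  obtain D n where D: "\<And>m. Sigma0 (omega_words UNIV) \<xi> {\<beta>. accepts (run_steps D) \<beta> m}"
    "B = {\<beta>. accepts (run_steps D) \<beta> n}"
    using represented_run_steps[OF Sigma0_represented(1)[OF B(1)]] by blast
  have Sigma: "Sigma0_complete \<xi> (omega_power (run_lang D))"
  proof (rule Sigma0_completeI)
    show "Sigma0 (omega_words UNIV) \<xi> (omega_power (run_lang D))"
      by (rule omega_power_Sigma0[OF assms False D(1)])
    have "\<beta> \<in> B \<longleftrightarrow> code n \<beta> \<in> omega_power (run_lang D)" for \<beta>
      by (simp add: D(2) code_in_omega_power_iff)
    then show "Sigma0_hard \<xi> (omega_power (run_lang D))"
      using B(2) reduces_compose[OF _ continuous_map_code] unfolding Sigma0_hard_def by metis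
  qed
  obtain D' n' where D': "\<And>m. Pi0 (omega_words UNIV) \<xi> {\<beta>. accepts (run_steps D') \<beta> m}"
    "- B = {\<beta>. accepts (run_steps D') \<beta> n'}"
    using represented_run_steps[OF Sigma0_represented(2)[OF Pi0_compl[OF B(1)]]] by blast
  have "Pi0_complete \<xi> (omega_power (run_lang D'))"
  proof (rule Pi0_completeI)
    show "Pi0 (omega_words UNIV) \<xi> (omega_power (run_lang D'))"
      by (rule omega_power_Pi0[OF assms False D'(1)])
    have "\<beta> \<in> - B \<longleftrightarrow> code n' \<beta> \<in> omega_power (run_lang D')" for \<beta>
      by (simp add: D'(2) code_in_omega_power_iff)
    then show "Pi0_hard \<xi> (omega_power (run_lang D'))"
      using Pi0_hard_compl[OF B(2)] reduces_compose[OF _ continuous_map_code]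
      unfolding Pi0_hard_def by metis
  qed
  with Sigma show ?thesis by blast
qed

end
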